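(* At a point $(g,e)\in G\times G$ there is a $\pi$-horizontal zero-curvature plane (with respect to $\langle\cdot,\cdot\rangle_1\oplus\langle\cdot,\cdot\rangle_1$) if and only if there are linearly independent $X,Y\in\mathfrak g$ satisfying all of: (1) $\langle X,\mathfrak h\rangle_0=\langle Y,\mathfrak h\rangle_0=0$; (2) $[X,Y]=[X_{\mathfrak k},Y_{\mathfrak k}]=[X_{\mathfrak p},Y_{\mathfrak p}]=0$; (3) $[\operatorname{Ad}_{g^{-1}}X,\operatorname{Ad}_{g^{-1}}Y]=[(\operatorname{Ad}_{g^{-1}}X)_{\mathfrak p},(\operatorname{Ad}_{g^{-1}}Y)_{\mathfrak p}]=0$.
   Context: Let $G=G_2=\operatorname{Aut}(\mathbb{O})\subseteq SO(7)$ acting on $\operatorname{Im}\mathbb{O}$ with ordered orthonormal basis $(i,j,k,\ell,i\ell,j\ell,k\ell)$, $K=\{g\in G: g(i)=i\}\cong SU(3)$, and $H=\{g\in G: g\text{ preserves the oriented plane with oriented basis }(j,k)\}\cong U(2)\subseteq K$. Let $\mathfrak g\supseteq\mathfrak k\supseteq\mathfrak h$ be the Lie algebras, $\langle X,Y\rangle_0=-\operatorname{tr}(XY)$, $\mathfrak p$ the $\langle\cdot,\cdot\rangle_0$-orthogonal complement of $\mathfrak k$ in $\mathfrak g$, $X=X_{\mathfrak k}+X_{\mathfrak p}$. Fix $t>0$, $\phi(Y)=\frac{t}{t+1}Y_{\mathfrak k}+Y_{\mathfrak p}$, and let $\langle\cdot,\cdot\rangle_1$ be the left-invariant metric on $G$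 with $\langle X,Y\rangle_1=\langle X,\phi(Y)\rangle_0$ at $e$. Equip $G\times G$ with $\langle\cdot,\cdot\rangle_1\oplus\langle\cdot,\cdot\rangle_1$; $G\times H$ acts freely and isometrically by $(g',h)\cdot(g_1,g_2)=(g'g_1,g'g_2h^{-1})$, and $\pi:G\times G\to G/H$, $\pi(g_1,g_2)=g_1^{-1}g_2H$, is the quotient map; "horizontal" means orthogonal to the orbits of this action. (After left translation to $(e,e)$, the horizontal space at $(g,e)$ consists of the vectors $\widehat X=(\phi^{-1}(-\operatorname{Ad}_{g^{-1}}X),\phi^{-1}(X))$ with $X\in\mathfrak g$, $\langle X,\mathfrak h\rangle_0=0$.) *)

theory Defs
  imports "HOL-Analysis.Analysis" "HOL-Library.Numeral_Type"
begin

datatype quat = Q real real real real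

fun qmul :: "quat \<Rightarrow> quat \<Rightarrow> quat" where
  "qmul (Q a0 a1 a2 a3) (Q b0 b1 b2 b3) =
     Q (a0*b0 - a1*b1 - a2*b2 - a3*b3)
       (a0*b1 + a1*b0 + a2*b3 - a3*b2)
       (a0*b2 - a1*b3 + a2*b0 + a3*b1)
       (a0*b3 + a1*b2 - a2*b1 + a3*b0)"

fun qadd :: "quat \<Rightarrow> quat \<Rightarrow> quat" where
  "qadd (Q a0 a1 a2 a3) (Q b0 b1 b2 b3) = Q (a0+b0) (a1+b1) (a2+b2) (a3+b3)"

fun qneg :: "quat \<Rightarrow> quat" where
  "qneg (Q a0 a1 a2 a3) = Q (-a0) (-a1) (-a2) (-a3)"

fun qconj :: "quat \<Rightarrow> quat" where
  "qconj (Q a0 a1 a2 a3) = Q a0 (-a1) (-a2) (-a3)"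

text \<open>Octonions as pairs of quaternions: (a,b)(c,d) = (ac - conj(d) b, d a + b conj(c)).
  With l = (0,1) this gives i l = (0,i), j l = (0,j), k l = (0,k).\<close>
datatype oct = Oct quat quat

fun omul :: "oct \<Rightarrow> oct \<Rightarrow> oct" where
  "omul (Oct a b) (Oct c d) = Oct (qadd (qmul a c) (qneg (qmul (qconj d) b)))
                            (qadd (qmul d a) (qmul b (qconj c)))"

fun oadd :: "oct \<Rightarrow> oct \<Rightarrow> oct" where
  "oadd (Oct a b) (Oct c d) = Oct (qadd a c) (qadd b d)"

text \<open>Im O identified with real^7 via the ordered basis (i,j,k,l,il,jl,kl),
  i.e. coordinates 0,...,6 of type 7.\<close>
definition emb :: "real^7 \<Rightarrow> oct" where
  "emb x = Oct (Q 0 (x$0) (x$1) (x$2)) (Q (x$3) (x$4) (x$5) (x$6))"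

fun ore :: "oct \<Rightarrow> real" where
  "ore (Oct (Q r _ _ _) _) = r"

fun oim :: "oct \<Rightarrow> real^7" where
  "oim (Oct (Q _ a b c) (Q d e f h)) =
     (\<chi> n. if n = 0 then a else if n = 1 then b else if n = 2 then c else
            if n = 3 then d else if n = 4 then e else if n = 5 then f else h)"

definition oreal :: "real \<Rightarrow> oct" where
  "oreal r = Oct (Q r 0 0 0) (Q 0 0 0 0)"

definition oext :: "real^7^7 \<Rightarrow> oct \<Rightarrow> oct" where
  "oext g z = oadd (oreal (ore z)) (emb (g *v oim z))"

definition G2 :: "(real^7^7) set" where
  "G2 = {g. orthogonal_matrix g \<and> det g = 1 \<and>
         (\<forall>x y. oext g (omul (emb x) (emb y)) = omul (emb (g *v x)) (emb (g *v y)))}"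

definition e_i :: "real^7" where "e_i = axis 0 1"
definition e_j :: "real^7" where "e_j = axis 1 1"
definition e_k :: "real^7" where "e_k = axis 2 1"

definition K_grp :: "(real^7^7) set" where
  "K_grp = {g \<in> G2. g *v e_i = e_i}"

text \<open>g preserves the oriented plane with oriented basis (j,k).\<close>
definition H_grp :: "(real^7^7) set" where
  "H_grp = {g \<in> G2. g *v e_j \<in> span {e_j, e_k} \<and> g *v e_k \<in> span {e_j, e_k} \<and>
       ((g *v e_j) \<bullet> e_j) * ((g *v e_k) \<bullet> e_k) - ((g *v e_k) \<bullet> e_j) * ((g *v e_j) \<bullet> e_k) > 0}"

definition lie_alg :: "(real^7^7) set \<Rightarrow> (real^7^7) set" where
  "lie_alg S = {X. \<exists>c::real \<Rightarrow> real^7^7. (\<forall>s. c s \<in> S) \<and> c 0 = mat 1 \<and>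
                    (c has_vector_derivative X) (at 0)}"

definition gg :: "(real^7^7) set" where "gg = lie_alg G2"
definition kk :: "(real^7^7) set" where "kk = lie_alg K_grp"
definition hh :: "(real^7^7) set" where "hh = lie_alg H_grp"

definition lbr :: "real^7^7 \<Rightarrow> real^7^7 \<Rightarrow> real^7^7" where
  "lbr X Y = X ** Y - Y ** X"

definition ip0 :: "real^7^7 \<Rightarrow> real^7^7 \<Rightarrow> real" where
  "ip0 X Y = - trace (X ** Y)"

definition Ad_inv :: "real^7^7 \<Rightarrow> real^7^7 \<Rightarrow> real^7^7" where
  "Ad_inv g X = matrix_inv g ** X ** g"

definition kpart :: "real^7^7 \<Rightarrow> real^7^7" where
  "kpart X = (THE Y. Y \<in> kk \<and> (\<forall>Z\<in>kk. ip0 (X - Y) Z = 0))"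

definition ppart :: "real^7^7 \<Rightarrow> real^7^7" where
  "ppart X = X - kpart X"

definition phi :: "real \<Rightarrow> real^7^7 \<Rightarrow> real^7^7" where
  "phi t Y = (t / (t + 1)) *\<^sub>R kpart Y + ppart Y"

definition ip1 :: "real \<Rightarrow> real^7^7 \<Rightarrow> real^7^7 \<Rightarrow> real" where
  "ip1 t X Y = ip0 X (phi t Y)"

type_synonym gg2 = "(real^7^7) \<times> (real^7^7)"

definition br2 :: "gg2 \<Rightarrow> gg2 \<Rightarrow> gg2" where
  "br2 U V = (lbr (fst U) (fst V), lbr (snd U) (snd V))"

definition ip2 :: "real \<Rightarrow> gg2 \<Rightarrow> gg2 \<Rightarrow> real" where
  "ip2 t U V = ip1 t (fst U) (fst V) + ip1 t (snd U) (snd V)"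

text \<open>Levi-Civita connection of a left-invariant metric on left-invariant fields
  (Koszul formula), Lie algebra L with bracket br and inner product ip.\<close>
definition lc :: "('a::real_vector) set \<Rightarrow> ('a \<Rightarrow> 'a \<Rightarrow> 'a) \<Rightarrow> ('a \<Rightarrow> 'a \<Rightarrow> real) \<Rightarrow> 'a \<Rightarrow> 'a \<Rightarrow> 'a::real_vector" where
  "lc L br ip X Y = (THE W. W \<in> L \<and> (\<forall>Z\<in>L.
      ip W Z = (1/2) * (ip (br X Y) Z - ip (br Y Z) X + ip (br Z X) Y)))"

definition curv :: "('a::real_vector) set \<Rightarrow> ('a \<Rightarrow> 'a \<Rightarrow> 'a) \<Rightarrow> ('a \<Rightarrow> 'a \<Rightarrow> real) \<Rightarrow> 'a \<Rightarrow> 'a \<Rightarrow> 'a \<Rightarrow> 'a::real_vector" where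
  "curv L br ip X Y Z = lc L br ip X (lc L br ip Y Z) - lc L br ip Y (lc L br ip X Z)
                        - lc L br ip (br X Y) Z"

definition sec_curv :: "('a::real_vector) set \<Rightarrow> ('a \<Rightarrow> 'a \<Rightarrow> 'a) \<Rightarrow> ('a \<Rightarrow> 'a \<Rightarrow> real) \<Rightarrow> 'a \<Rightarrow> 'a \<Rightarrow> real" where
  "sec_curv L br ip X Y = ip (curv L br ip X Y Y) X / (ip X X * ip Y Y - (ip X Y)^2)"

definition lin_indep2 :: "'a::real_vector \<Rightarrow> 'a \<Rightarrow> bool" where
  "lin_indep2 X Y \<longleftrightarrow> (\<forall>a b::real. a *\<^sub>R X + b *\<^sub>R Y = 0 \<longrightarrow> a = 0 \<and> b = 0)"

text \<open>Tangent space to the (G x H)-orbit through (g,e), left-translated to (e,e):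
  derivative of s |-> (exp(sZ) g, exp(sZ) exp(-sW)) is (Z g, Z - W).\<close>
definition vert :: "real^7^7 \<Rightarrow> gg2 set" where
  "vert g = {(Ad_inv g Z, Z - W) | Z W. Z \<in> gg \<and> W \<in> hh}"

definition horiz :: "real \<Rightarrow> real^7^7 \<Rightarrow> gg2 set" where
  "horiz t g = {V \<in> gg \<times> gg. \<forall>U \<in> vert g. ip2 t V U = 0}"

end

theory Submission
  imports Defs
begin

text \<open>
  The map \<open>X \<mapsto> (\<phi>\<^bsup>-1\<^esup>(- Ad X), \<phi>\<^bsup>-1\<^esup> X)\<close> parametrises the horizontal space by the complement of
  \<open>\<frak>h\<close>. The numerator of the sectional curvature of the product is the sum of those of the two factors,
  and in each factor it is a sum of squares which vanishes on the plane spanned by \<open>\<phi>\<^bsup>-1\<^esup> A\<close>,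
  \<open>\<phi>\<^bsup>-1\<^esup> B\<close> exactly if \<open>[A, B] = [A\<^bsub>\<frak>k\<^esub>, B\<^bsub>\<frak>k\<^esub>] = 0\<close>. For commuting \<open>A, B\<close> the
  condition \<open>[A\<^bsub>\<frak>k\<^esub>, B\<^bsub>\<frak>k\<^esub>] = 0\<close> says that \<open>[A\<^bsub>\<frak>p\<^esub>, B\<^bsub>\<frak>p\<^esub>]\<close> has no
  \<open>\<frak>k\<close>-component. As \<open>SU(3)\<close> acts transitively on the unit sphere of \<open>\<frak>p = \<complex>\<^sup>3\<close>, this already
  makes \<open>A\<^bsub>\<frak>p\<^esub>\<close> and \<open>B\<^bsub>\<frak>p\<^esub>\<close> linearly dependent, so they commute.
\<close>

subsection \<open>Octonion multiplication in coordinates\<close>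

lemma UNIV_7: "(UNIV :: 7 set) = {0, 1, 2, 3, 4, 5, 6}"
proof -
  have "card {0, 1, 2, 3, 4, 5, 6 :: 7} = CARD(7)" by simp
  then show ?thesis
    by (metis card_subset_eq finite subset_UNIV)
qed

lemma sum_7: "sum f (UNIV :: 7 set) = f 0 + f 1 + f 2 + f 3 + f 4 + f 5 + f 6"
  unfolding UNIV_7 by (simp add: add.assoc)

lemma forall_7: "(\<forall>i :: 7. P i) \<longleftrightarrow> P 0 \<and> P 1 \<and> P 2 \<and> P 3 \<and> P 4 \<and> P 5 \<and> P 6"
  using UNIV_7 by (metis UNIV_I insertE singletonD)

lemma vec_eq_7: "x = y \<longleftrightarrow> x $ 0 = y $ 0 \<and> x $ 1 = y $ 1 \<and> x $ 2 = y $ 2 \<and> x $ 3 = y $ 3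
    \<and> x $ 4 = y $ 4 \<and> x $ 5 = y $ 5 \<and> x $ 6 = y $ 6" for x y :: "'a ^ 7"
  by (simp add: vec_eq_iff forall_7)

text \<open>The seven-dimensional cross product on imaginary octonions.\<close>

definition imul :: "real^7 \<Rightarrow> real^7 \<Rightarrow> real^7" where
  "imul x y = oim (omul (emb x) (emb y))"

lemma imul_nth:
  "imul x y $ 0 = x$1 * y$2 - x$2 * y$1 + x$3 * y$4 - x$4 * y$3 - x$5 * y$6 + x$6 * y$5"
  "imul x y $ 1 = x$2 * y$0 - x$0 * y$2 + x$3 * y$5 - x$5 * y$3 + x$4 * y$6 - x$6 * y$4"
  "imul x y $ 2 = x$0 * y$1 - x$1 * y$0 + x$3 * y$6 - x$6 * y$3 - x$4 * y$5 + x$5 * y$4"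
  "imul x y $ 3 = x$4 * y$0 - x$0 * y$4 + x$5 * y$1 - x$1 * y$5 + x$6 * y$2 - x$2 * y$6"
  "imul x y $ 4 = x$0 * y$3 - x$3 * y$0 - x$1 * y$6 + x$6 * y$1 + x$2 * y$5 - x$5 * y$2"
  "imul x y $ 5 = x$1 * y$3 - x$3 * y$1 + x$0 * y$6 - x$6 * y$0 + x$4 * y$2 - x$2 * y$4"
  "imul x y $ 6 = x$2 * y$3 - x$3 * y$2 - x$0 * y$5 + x$5 * y$0 + x$1 * y$4 - x$4 * y$1"
  by (simp_all add: imul_def emb_def)

lemma ore_omul_emb: "ore (omul (emb x) (emb y)) = - (x \<bullet> y)"
  by (simp add: emb_def inner_vec_def sum_7)

text \<open>The real part of a product of imaginary octonions is minus their inner product, so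
  comparing real and imaginary parts splits multiplicativity into preservation of the inner product
  and of the cross product.\<close>

lemma oext_eq_iff: "oext g (omul (emb x) (emb y)) = omul (emb u) (emb v)
    \<longleftrightarrow> x \<bullet> y = u \<bullet> v \<and> g *v imul x y = imul u v"
proof -
  have decomp: "z = oadd (oreal (ore z)) (emb (oim z))" for z
    by (cases z rule: oim.cases) (simp add: oreal_def emb_def)
  have inj: "oadd (oreal r) (emb a) = oadd (oreal s) (emb b) \<longleftrightarrow> r = s \<and> a = b" for r s a b
    by (auto simp: oreal_def emb_def vec_eq_7)
  have "oext g (omul (emb x) (emb y)) = omul (emb u) (emb v) \<longleftrightarrow>
     oadd (oreal (- (x \<bullet> y))) (emb (g *v imul x y)) = oadd (oreal (- (u \<bullet> v))) (emb (imul u v))"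
    using decomp[of "omul (emb u) (emb v)"] by (simp add: oext_def ore_omul_emb imul_def)
  then show ?thesis by (simp add: inj)
qed

text \<open>Orthogonal matrices preserve inner products, so multiplicativity reduces to
  compatibility with \<open>imul\<close>. This is the form that is differentiated along
  curves.\<close>

lemma G2_iff: "g \<in> G2 \<longleftrightarrow> orthogonal_matrix g \<and> det g = 1 \<and>
    (\<forall>x y. g *v imul x y = imul (g *v x) (g *v y))"
proof -
  have "x \<bullet> y = (g *v x) \<bullet> (g *v y)" if "orthogonal_matrix g" for x y
    using that by (simp add: orthogonal_matrix dot_lmul_matrix[symmetric] flip: matrix_vector_mul_assoc)
       (metis matrix_vector_mul_assoc matrix_vector_mul_lid transpose_matrix_vector)
  then show ?thesis
    unfolding G2_def oext_eq_iff by blast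
qed

lemma bounded_bilinear_imul: "bounded_bilinear imul"
proof -
  have "bilinear imul"
    unfolding bilinear_def
    by (intro conjI allI linearI) (simp_all add: vec_eq_7 imul_nth algebra_simps)
  then show ?thesis by (simp add: bilinear_conv_bounded_bilinear)
qed

subsection \<open>Lie algebras of orthogonal matrix groups\<close>

lemma bounded_bilinear_matrix_mult:
  "bounded_bilinear ((**) :: real^'n^'n \<Rightarrow> real^'n^'n \<Rightarrow> real^'n^'n)"
proof -
  have "bilinear ((**) :: real^'n^'n \<Rightarrow> real^'n^'n \<Rightarrow> real^'n^'n)"
    unfolding bilinear_def
    by (intro conjI allI linearI)
      (simp_all add: vec_eq_iff matrix_matrix_mult_def
        sum_distrib_left algebra_simps sum.distrib)
  then show ?thesis by (simp add: bilinear_conv_bounded_bilinear)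
qed

lemma bounded_bilinear_matrix_vector_mult:
  "bounded_bilinear ((*v) :: real^'n^'m \<Rightarrow> real^'n \<Rightarrow> real^'m)"
proof -
  have "bilinear ((*v) :: real^'n^'m \<Rightarrow> real^'n \<Rightarrow> real^'m)"
    unfolding bilinear_def
    by (intro conjI allI linearI)
      (simp_all add: matrix_vector_mult_def vec_eq_iff sum_distrib_left algebra_simps sum.distrib)
  then show ?thesis by (simp add: bilinear_conv_bounded_bilinear)
qed

lemma bounded_linear_transpose: "bounded_linear (transpose :: real^'n^'m \<Rightarrow> real^'m^'n)"
  unfolding linear_conv_bounded_linear[symmetric] by (rule linearI) (simp_all add: transpose_def vec_eq_iff)

interpretation mm: bounded_bilinear "(**) :: real^'n^'n \<Rightarrow> real^'n^'n \<Rightarrow> real^'n^'n"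
  by (rule bounded_bilinear_matrix_mult)

interpretation mv: bounded_bilinear "(*v) :: real^'n^'m \<Rightarrow> real^'n \<Rightarrow> real^'m"
  by (rule bounded_bilinear_matrix_vector_mult)

interpretation imul: bounded_bilinear imul
  by (rule bounded_bilinear_imul)

text \<open>The difference quotients lie in \<open>S\<close>, and subspaces of a Euclidean space are
  closed.\<close>

lemma has_vector_derivative_in_subspace:
  fixes f :: "real \<Rightarrow> 'a::euclidean_space"
  assumes "subspace S" and "\<And>s. f s \<in> S" and f: "(f has_vector_derivative D) (at 0)"
  shows "D \<in> S"
proof -
  have lim: "((\<lambda>h. (1 / h) *\<^sub>R (f h - f 0)) \<longlongrightarrow> D) (at 0)"
  proof -
    have "((\<lambda>h. norm (f (0 + h) - f 0 - h *\<^sub>R D) / norm h) \<longlongrightarrow> 0) (at 0)"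
      using f unfolding has_vector_derivative_def has_derivative_at by blast
    moreover have "norm (f (0 + h) - f 0 - h *\<^sub>R D) / norm h
        = norm ((1 / h) *\<^sub>R (f h - f 0) - D)" if "h \<noteq> 0" for h
    proof -
      have "(1 / h) *\<^sub>R (f h - f 0) - D = (1 / h) *\<^sub>R (f h - f 0 - h *\<^sub>R D)"
        using that by (simp add: algebra_simps)
      then show ?thesis by simp
    qed
    ultimately have "((\<lambda>h. norm ((1 / h) *\<^sub>R (f h - f 0) - D)) \<longlongrightarrow> 0) (at 0)"
      by (subst tendsto_cong) (auto simp: eventually_at_filter elim: eventually_mono)
    then show ?thesis
      by (rule LIM_zero_cancel[OF tendsto_norm_zero_cancel])
  qed
  have "(1 / h) *\<^sub>R (f h - f 0) \<in> S" for h
    by (rule subspace_scale[OF assms(1) subspace_diff[OF assms(1) assms(2) assms(2)]])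
  then show ?thesis
    by (intro Lim_in_closed_set[OF closed_subspace[OF assms(1)] _ at_neq_bot lim]) simp
qed

text \<open>Closure under transposes is closure under inverses here. Elements of
  \<open>lie_alg S\<close> are velocities of curves, so each Lie algebra operation comes from one on
  curves: scaling from reparametrisation, addition from the pointwise product, the bracket from
  conjugation.\<close>

locale orthogonal_matrix_group =
  fixes S :: "(real^7^7) set"
  assumes orthogonal: "g \<in> S \<Longrightarrow> orthogonal_matrix g"
    and one_closed: "mat 1 \<in> S"
    and mult_closed: "\<lbrakk>g \<in> S; h \<in> S\<rbrakk> \<Longrightarrow> g ** h \<in> S"
    and transpose_closed: "g \<in> S \<Longrightarrow> transpose g \<in> S"
begin

lemma lie_alg_zero: "0 \<in> lie_alg S"
  unfolding lie_alg_def
  by (rule CollectI, rule exI[of _ "\<lambda>_. mat 1"]) (simp add: one_closed)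

lemma lie_alg_scale: assumes "X \<in> lie_alg S" shows "r *\<^sub>R X \<in> lie_alg S"
proof -
  from assms obtain c where c: "\<And>s. c s \<in> S" "c 0 = mat 1" "(c has_vector_derivative X) (at 0)"
    by (auto simp: lie_alg_def)
  have "((\<lambda>s. c (r * s)) has_vector_derivative r *\<^sub>R X) (at 0)"
    using vector_diff_chain_at[of "\<lambda>s. r * s" r 0 c X] c(3)
    by (auto simp: o_def intro!: derivative_eq_intros simp flip: has_real_derivative_iff_has_vector_derivative)
  then show ?thesis
    unfolding lie_alg_def using c(1,2) by (intro CollectI exI[of _ "\<lambda>s. c (r * s)"]) simp
qed

lemma lie_alg_add: assumes "X \<in> lie_alg S" "Y \<in> lie_alg S" shows "X + Y \<in> lie_alg S"
proof -
  from assms obtain c d where c: "\<And>s. c s \<in> S" "c 0 = mat 1" "(c has_vector_derivative X) (at 0)"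
    and d: "\<And>s. d s \<in> S" "d 0 = mat 1" "(d has_vector_derivative Y) (at 0)"
    by (auto simp: lie_alg_def)
  have "((\<lambda>s. c s ** d s) has_vector_derivative X + Y) (at 0)"
    using mm.has_vector_derivative[OF c(3) d(3)] c(2) d(2) by (simp add: add.commute)
  then show ?thesis
    unfolding lie_alg_def using c d mult_closed
    by (intro CollectI exI[of _ "\<lambda>s. c s ** d s"]) simp
qed

lemma subspace_lie_alg: "subspace (lie_alg S)"
  by (simp add: subspace_def lie_alg_zero lie_alg_scale lie_alg_add)

lemma lie_alg_skew: assumes "X \<in> lie_alg S" shows "transpose X = - X"
proof -
  from assms obtain c where c: "\<And>s. c s \<in> S" "c 0 = mat 1" "(c has_vector_derivative X) (at 0)"
    by (auto simp: lie_alg_def)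
  have "((\<lambda>s. c s ** transpose (c s)) has_vector_derivative transpose X + X) (at 0)"
    using mm.has_vector_derivative[OF c(3) bounded_linear.has_vector_derivative[OF bounded_linear_transpose c(3)]] c(2)
    by (simp add: transpose_mat)
  moreover have "(\<lambda>s. c s ** transpose (c s)) = (\<lambda>s. mat 1)"
    using orthogonal[OF c(1)] by (simp add: orthogonal_matrix_def)
  ultimately have "((\<lambda>s. mat 1 :: real^7^7) has_vector_derivative transpose X + X) (at 0)" by simp
  from vector_derivative_unique_at[OF this has_vector_derivative_const]
  have "transpose X + X = 0" .
  then show ?thesis by (simp add: eq_neg_iff_add_eq_0)
qed

lemma lie_alg_conj:
  assumes "g \<in> S" "X \<in> lie_alg S" shows "g ** X ** transpose g \<in> lie_alg S"
proof -
  from assms obtain c where c: "\<And>s. c s \<in> S" "c 0 = mat 1" "(c has_vector_derivative X) (at 0)"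
    by (auto simp: lie_alg_def)
  have "((\<lambda>s. g ** c s ** transpose g) has_vector_derivative g ** X ** transpose g) (at 0)"
    using bounded_linear.has_vector_derivative[OF mm.bounded_linear_left
      bounded_linear.has_vector_derivative[OF mm.bounded_linear_right c(3)]] .
  moreover have "g ** transpose g = mat 1"
    using orthogonal[OF assms(1)] by (simp add: orthogonal_matrix_def)
  ultimately show ?thesis
    unfolding lie_alg_def using c assms(1) mult_closed transpose_closed
    by (intro CollectI exI[of _ "\<lambda>s. g ** c s ** transpose g"]) simp
qed

text \<open>Conjugating \<open>Y\<close> by a curve with velocity \<open>X\<close> gives a curve
  inside the subspace \<open>lie_alg S\<close>; its derivative at 0 is the commutator because
  \<open>X\<close> is skew.\<close>

lemma lie_alg_lbr:
  assumes X: "X \<in> lie_alg S" and Y: "Y \<in> lie_alg S" shows "lbr X Y \<in> lie_alg S"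
proof -
  from X obtain c where c: "\<And>s. c s \<in> S" "c 0 = mat 1" "(c has_vector_derivative X) (at 0)"
    by (auto simp: lie_alg_def)
  have "((\<lambda>s. c s ** Y ** transpose (c s)) has_vector_derivative lbr X Y) (at 0)"
    using mm.has_vector_derivative[OF bounded_linear.has_vector_derivative[OF mm.bounded_linear_left c(3)]
        bounded_linear.has_vector_derivative[OF bounded_linear_transpose c(3)]] c(2) lie_alg_skew[OF X]
    by (simp add: transpose_mat lbr_def mm.minus_right)
  then show ?thesis
    by (rule has_vector_derivative_in_subspace[OF subspace_lie_alg lie_alg_conj[OF c(1) Y]])
qed

end

lemma lie_alg_mono: "S \<subseteq> T \<Longrightarrow> lie_alg S \<subseteq> lie_alg T"
  unfolding lie_alg_def by blast

section \<open>The groups G2 and K, and linear conditions on their Lie algebras\<close>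

lemma transpose_in_G2: assumes "g \<in> G2" shows "transpose g \<in> G2"
proof -
  have o: "orthogonal_matrix g" using assms by (simp add: G2_iff)
  then have 1: "transpose g *v (g *v z) = z" "g *v (transpose g *v z) = z" for z
    by (simp_all add: matrix_vector_mul_assoc orthogonal_matrix_def del: transpose_matrix_vector)
  have "transpose g *v imul x y = imul (transpose g *v x) (transpose g *v y)" for x y
    using assms 1 G2_iff by metis
  then show ?thesis
    using assms o by (simp add: G2_iff det_transpose orthogonal_matrix_transpose)
qed

lemma mult_in_G2: assumes "g \<in> G2" "h \<in> G2" shows "g ** h \<in> G2"
  using assms by (simp add: G2_iff orthogonal_matrix_mul det_mul flip: matrix_vector_mul_assoc)

lemma one_in_G2: "mat 1 \<in> G2"
  by (simp add: G2_iff orthogonal_matrix_id)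

interpretation G2: orthogonal_matrix_group G2
  by standard (simp_all add: mult_in_G2 transpose_in_G2 one_in_G2, simp add: G2_iff)

interpretation K_grp: orthogonal_matrix_group K_grp
proof
  fix g assume "g \<in> K_grp"
  then have g: "g \<in> G2" "g *v e_i = e_i" by (auto simp: K_grp_def)
  then show "orthogonal_matrix g" by (simp add: G2_iff)
  have "transpose g *v e_i = transpose g *v (g *v e_i)" using g by metis
  also have "\<dots> = e_i"
    using \<open>orthogonal_matrix g\<close>
    by (simp add: matrix_vector_mul_assoc orthogonal_matrix_def del: transpose_matrix_vector)
  finally show "transpose g \<in> K_grp" using g by (simp add: K_grp_def transpose_in_G2)
qed (auto simp: K_grp_def one_in_G2 mult_in_G2 simp flip: matrix_vector_mul_assoc)

lemma kk_subset_gg: "kk \<subseteq> gg"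
  unfolding kk_def gg_def by (rule lie_alg_mono) (auto simp: K_grp_def)

text \<open>Lets \<open>W\<close> be 0 in \<open>vert\<close>, so that the vectors
  \<open>(Ad_inv g Z, Z)\<close> are vertical.\<close>

lemma zero_in_hh: "0 \<in> hh"
proof -
  have "mat 1 \<in> H_grp"
    by (simp add: H_grp_def one_in_G2 span_base e_j_def e_k_def inner_axis_axis)
  then show ?thesis
    unfolding hh_def lie_alg_def
    by (intro CollectI exI[of _ "\<lambda>_. mat 1"]) simp
qed

lemma gg_derivation: assumes "X \<in> gg"
  shows "X *v imul x y = imul (X *v x) y + imul x (X *v y)"
proof -
  from assms obtain c where c: "\<And>s. c s \<in> G2" "c 0 = mat 1" "(c has_vector_derivative X) (at 0)"
    by (auto simp: gg_def lie_alg_def)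
  have 1: "((\<lambda>s. c s *v z) has_vector_derivative X *v z) (at 0)" for z
    using bounded_linear.has_vector_derivative[OF mv.bounded_linear_left c(3)] .
  have "((\<lambda>s. imul (c s *v x) (c s *v y)) has_vector_derivative
      imul x (X *v y) + imul (X *v x) y) (at 0)"
    using imul.has_vector_derivative[OF 1 1] c(2) by simp
  moreover have "(\<lambda>s. imul (c s *v x) (c s *v y)) = (\<lambda>s. c s *v imul x y)"
    using c(1) by (simp add: G2_iff)
  ultimately have "((\<lambda>s. c s *v imul x y) has_vector_derivative
      imul x (X *v y) + imul (X *v x) y) (at 0)" by simp
  from vector_derivative_unique_at[OF 1 this] show ?thesis by (simp add: add.commute)
qed

lemma kk_e_i: assumes "X \<in> kk" shows "X *v e_i = 0"
proof -
  from assms obtain c where c: "\<And>s. c s \<in> K_grp" "c 0 = mat 1" "(c has_vector_derivative X) (at 0)"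
    by (auto simp: kk_def lie_alg_def)
  have "((\<lambda>s. c s *v e_i) has_vector_derivative X *v e_i) (at 0)"
    using bounded_linear.has_vector_derivative[OF mv.bounded_linear_left c(3)] .
  moreover have "(\<lambda>s. c s *v e_i) = (\<lambda>s. e_i)"
    using c(1) by (simp add: K_grp_def)
  ultimately have "((\<lambda>s. e_i) has_vector_derivative X *v e_i) (at 0)" by simp
  from vector_derivative_unique_at[OF this has_vector_derivative_const] show ?thesis .
qed

subsection \<open>The subalgebra \<open>\<frak>s\<frak>u(3)\<close> and its complement\<close>

text \<open>Since \<open>J^3 = - J\<close>, Rodrigues' formula gives the exponential of
  \<open>s J\<close> as a polynomial in \<open>J\<close>, and the group law becomes the addition
  formulas for sine and cosine. The hypothesis \<open>inv\<close> controls the quadratic terms when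
  this one-parameter group acts on both factors of a product.\<close>

lemma in_kk_if_cube:
  assumes skew: "transpose J = - J" and fix0: "J *v e_i = 0"
    and deriv: "\<And>x y. J *v imul x y = imul (J *v x) y + imul x (J *v y)"
    and cube: "\<And>x. J *v (J *v (J *v x)) = - (J *v x)"
    and inv: "\<And>x y. imul (J *v (J *v x)) (J *v (J *v y)) = imul (J *v x) (J *v y)"
  shows "J \<in> kk"
proof -
  define P where "P = J ** J"
  define c where "c s = mat 1 + (1 - cos s) *\<^sub>R P + sin s *\<^sub>R J" for s :: real
  have P: "P *v x = J *v (J *v x)" for x
    by (simp add: P_def matrix_vector_mul_assoc)
  have prods: "P ** J = - J" "J ** P = - J" "P ** P = - P" "J ** J = P"
    by (simp_all add: matrix_eq P cube mv.minus_left mv.minus_right flip: matrix_vector_mul_assoc)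
  have P_sym: "transpose P = P"
    by (simp add: P_def matrix_transpose_mul skew mm.minus_left mm.minus_right)
  have mult: "(mat 1 + p *\<^sub>R P + q *\<^sub>R J) ** (mat 1 + p' *\<^sub>R P + q' *\<^sub>R J)
      = mat 1 + (p + p' - p * p' + q * q') *\<^sub>R P + (q + q' - p * q' - q * p') *\<^sub>R J" for p q p' q'
    by (simp add: mm.add_left mm.add_right mm.scaleR_left mm.scaleR_right prods algebra_simps)
  have c_add: "c s ** c r = c (s + r)" for s r
    unfolding c_def mult cos_add sin_add by (simp add: algebra_simps)
  have c0: "c 0 = mat 1" by (simp add: c_def)
  have "transpose (c s) = c (- s)" for s
    by (simp add: c_def skew P_sym transpose_mat linear_add[OF bounded_linear.linear[OF bounded_linear_transpose]]
       linear_scale[OF bounded_linear.linear[OF bounded_linear_transpose]])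
  then have orth: "orthogonal_matrix (c s)" for s
    by (simp add: orthogonal_matrix_def c_add c0)
  \<comment> \<open>An orthogonal matrix has determinant 1 or -1; being the square of
    \<open>c (s/2)\<close> excludes -1.\<close>
  have det: "det (c s) = 1" for s
  proof -
    have "det (c s) = (det (c (s/2)))\<^sup>2"
      using det_mul[of "c (s/2)" "c (s/2)"] by (simp add: c_add power2_eq_square)
    moreover have "det (c (s/2)) = 1 \<or> det (c (s/2)) = -1"
      using orth det_orthogonal_matrix by blast
    ultimately show ?thesis by auto
  qed
  have cv: "c s *v x = x + (1 - cos s) *\<^sub>R (J *v (J *v x)) + sin s *\<^sub>R (J *v x)" for s x
    by (simp add: c_def mv.add_left mv.scaleR_left P)
  have "c s *v imul x y = imul (c s *v x) (c s *v y)" for s x y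
  proof -
    define C S where "C = 1 - cos s" and "S = sin s"
    have CS: "C * C + S * S = C + C"
      unfolding C_def S_def using sin_cos_squared_add[of s] by (simp add: power2_eq_square algebra_simps)
    \<comment> \<open>Replace \<open>y\<close> by \<open>J *v y\<close> in \<open>inv\<close> and
      use \<open>cube\<close>. The two mixed terms in the expansion below then cancel.\<close>
    have mixed: "imul (J *v (J *v x)) (J *v y) = - imul (J *v x) (J *v (J *v y))"
      using inv[of x "J *v y"] by (simp add: cube imul.minus_right) (metis minus_minus)
    have "imul (c s *v x) (c s *v y) = imul x y + C *\<^sub>R (imul (J *v (J *v x)) y + imul x (J *v (J *v y)))
        + S *\<^sub>R (imul (J *v x) y + imul x (J *v y)) + (C * C + S * S) *\<^sub>R imul (J *v x) (J *v y)"
      unfolding cv C_def[symmetric] S_def[symmetric]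
        imul.add_left imul.add_right imul.scaleR_left imul.scaleR_right inv mixed
      by (simp add: scaleR_add_left scaleR_add_right scaleR_diff_right mult.commute)
    \<comment> \<open>Applying \<open>deriv\<close> twice produces
      \<open>imul (J *v x) (J *v y)\<close> twice, which matches the coefficient
      \<open>C * C + S * S = C + C\<close>.\<close>
    also have "\<dots> = c s *v imul x y"
      unfolding cv C_def[symmetric] S_def[symmetric] CS deriv mv.add_right
      by (simp only: scaleR_add_left scaleR_add_right ac_simps)
    finally show ?thesis ..
  qed
  then have cK: "c s \<in> K_grp" for s
    using orth det by (simp add: K_grp_def G2_iff cv fix0)
  have "((\<lambda>s::real. 1 - cos s) has_real_derivative 0) (at 0)"
    by (rule DERIV_cong, rule derivative_intros, (rule derivative_intros)+) simp
  moreover have "(sin has_real_derivative 1) (at (0::real))"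
    using DERIV_sin[of "0::real"] by simp
  ultimately have "(c has_vector_derivative (0 + 0 *\<^sub>R P + 1 *\<^sub>R J)) (at 0)"
    unfolding c_def has_real_derivative_iff_has_vector_derivative
    by (intro has_vector_derivative_add has_vector_derivative_const
        bounded_linear.has_vector_derivative[OF bounded_linear_scaleR_left])
  then have "(c has_vector_derivative J) (at 0)" by simp
  then show ?thesis
    unfolding kk_def lie_alg_def using cK c0 by blast
qed

text \<open>Rotation generator with \<open>e\<^sub>a \<mapsto> e\<^sub>b\<close> and \<open>e\<^sub>c \<mapsto> e\<^sub>d\<close>.\<close>

definition rot_gen :: "7 \<Rightarrow> 7 \<Rightarrow> 7 \<Rightarrow> 7 \<Rightarrow> real^7^7" where
  "rot_gen a b c d = (\<chi> i j. (if i = b \<and> j = a then 1 else 0) - (if i = a \<and> j = b then 1 else 0)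
     + (if i = d \<and> j = c then 1 else 0) - (if i = c \<and> j = d then 1 else 0))"

lemma rot_gen_mult_nth: "(rot_gen a b c d *v x) $ i =
    (if i = b then x $ a else 0) - (if i = a then x $ b else 0)
     + (if i = d then x $ c else 0) - (if i = c then x $ d else 0)"
proof -
  have entry: "(if i = q \<and> j = p then 1 else 0) * y = (if j = p then if i = q then y else 0 else 0)"
    for j p q :: 7 and y :: real by simp
  show ?thesis
    by (simp add: matrix_vector_mult_def rot_gen_def left_diff_distrib distrib_right entry
        sum.distrib sum_subtractf)
qed

lemma transpose_rot_gen: "transpose (rot_gen a b c d) = - rot_gen a b c d"
  by (simp add: transpose_def rot_gen_def vec_eq_iff conj_commute)

text \<open>Multiplication by \<open>i\<close> identifies the span of the last six basis vectors with \<open>\<complex>\<^sup>3\<close>, with complex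
  coordinates formed from the index pairs \<open>(1,2)\<close>, \<open>(3,4)\<close>, \<open>(6,5)\<close>; the following matrices are a
  basis of \<open>\<frak>s\<frak>u(3)\<close>.\<close>

definition su3_basis :: "(real^7^7) set" where
  "su3_basis = {rot_gen 1 3 2 4, rot_gen 1 4 3 2, rot_gen 1 6 2 5, rot_gen 1 5 6 2,
     rot_gen 3 6 4 5, rot_gen 3 5 6 4, rot_gen 1 2 4 3, rot_gen 3 4 5 6}"

lemma su3_basis_mult_nth:
  "(rot_gen 1 3 2 4 *v x) $ 0 = 0"
  "(rot_gen 1 3 2 4 *v x) $ 1 = - x $3"
  "(rot_gen 1 3 2 4 *v x) $ 2 = - x $4"
  "(rot_gen 1 3 2 4 *v x) $ 3 = x $1"
  "(rot_gen 1 3 2 4 *v x) $ 4 = x $2"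
  "(rot_gen 1 3 2 4 *v x) $ 5 = 0"
  "(rot_gen 1 3 2 4 *v x) $ 6 = 0"
  "(rot_gen 1 4 3 2 *v x) $ 0 = 0"
  "(rot_gen 1 4 3 2 *v x) $ 1 = - x $4"
  "(rot_gen 1 4 3 2 *v x) $ 2 = x $3"
  "(rot_gen 1 4 3 2 *v x) $ 3 = - x $2"
  "(rot_gen 1 4 3 2 *v x) $ 4 = x $1"
  "(rot_gen 1 4 3 2 *v x) $ 5 = 0"
  "(rot_gen 1 4 3 2 *v x) $ 6 = 0"
  "(rot_gen 1 6 2 5 *v x) $ 0 = 0"
  "(rot_gen 1 6 2 5 *v x) $ 1 = - x $6"
  "(rot_gen 1 6 2 5 *v x) $ 2 = - x $5"
  "(rot_gen 1 6 2 5 *v x) $ 3 = 0"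
  "(rot_gen 1 6 2 5 *v x) $ 4 = 0"
  "(rot_gen 1 6 2 5 *v x) $ 5 = x $2"
  "(rot_gen 1 6 2 5 *v x) $ 6 = x $1"
  "(rot_gen 1 5 6 2 *v x) $ 0 = 0"
  "(rot_gen 1 5 6 2 *v x) $ 1 = - x $5"
  "(rot_gen 1 5 6 2 *v x) $ 2 = x $6"
  "(rot_gen 1 5 6 2 *v x) $ 3 = 0"
  "(rot_gen 1 5 6 2 *v x) $ 4 = 0"
  "(rot_gen 1 5 6 2 *v x) $ 5 = x $1"
  "(rot_gen 1 5 6 2 *v x) $ 6 = - x $2"
  "(rot_gen 3 6 4 5 *v x) $ 0 = 0"
  "(rot_gen 3 6 4 5 *v x) $ 1 = 0"
  "(rot_gen 3 6 4 5 *v x) $ 2 = 0"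
  "(rot_gen 3 6 4 5 *v x) $ 3 = - x $6"
  "(rot_gen 3 6 4 5 *v x) $ 4 = - x $5"
  "(rot_gen 3 6 4 5 *v x) $ 5 = x $4"
  "(rot_gen 3 6 4 5 *v x) $ 6 = x $3"
  "(rot_gen 3 5 6 4 *v x) $ 0 = 0"
  "(rot_gen 3 5 6 4 *v x) $ 1 = 0"
  "(rot_gen 3 5 6 4 *v x) $ 2 = 0"
  "(rot_gen 3 5 6 4 *v x) $ 3 = - x $5"
  "(rot_gen 3 5 6 4 *v x) $ 4 = x $6"
  "(rot_gen 3 5 6 4 *v x) $ 5 = x $3"
  "(rot_gen 3 5 6 4 *v x) $ 6 = - x $4"
  "(rot_gen 1 2 4 3 *v x) $ 0 = 0"
  "(rot_gen 1 2 4 3 *v x) $ 1 = - x $2"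
  "(rot_gen 1 2 4 3 *v x) $ 2 = x $1"
  "(rot_gen 1 2 4 3 *v x) $ 3 = x $4"
  "(rot_gen 1 2 4 3 *v x) $ 4 = - x $3"
  "(rot_gen 1 2 4 3 *v x) $ 5 = 0"
  "(rot_gen 1 2 4 3 *v x) $ 6 = 0"
  "(rot_gen 3 4 5 6 *v x) $ 0 = 0"
  "(rot_gen 3 4 5 6 *v x) $ 1 = 0"
  "(rot_gen 3 4 5 6 *v x) $ 2 = 0"
  "(rot_gen 3 4 5 6 *v x) $ 3 = - x $4"
  "(rot_gen 3 4 5 6 *v x) $ 4 = x $3"
  "(rot_gen 3 4 5 6 *v x) $ 5 = - x $6"
  "(rot_gen 3 4 5 6 *v x) $ 6 = x $5"
  by (simp_all add: rot_gen_mult_nth)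

text \<open>Each generator is a quarter turn in two orthogonal coordinate planes and zero on the
  remaining coordinates, so its cube is its negative and the criterion applies.\<close>

lemma su3_basis_subset_kk: "su3_basis \<subseteq> kk"
  unfolding su3_basis_def
proof (intro insert_subsetI empty_subsetI)
  show "rot_gen 1 3 2 4 \<in> kk"
    by (rule in_kk_if_cube)
      (simp_all add: transpose_rot_gen vec_eq_7 su3_basis_mult_nth imul_nth e_i_def axis_def algebra_simps)
  show "rot_gen 1 4 3 2 \<in> kk"
    by (rule in_kk_if_cube)
      (simp_all add: transpose_rot_gen vec_eq_7 su3_basis_mult_nth imul_nth e_i_def axis_def algebra_simps)
  show "rot_gen 1 6 2 5 \<in> kk"
    by (rule in_kk_if_cube)
      (simp_all add: transpose_rot_gen vec_eq_7 su3_basis_mult_nth imul_nth e_i_def axis_def algebra_simps)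
  show "rot_gen 1 5 6 2 \<in> kk"
    by (rule in_kk_if_cube)
      (simp_all add: transpose_rot_gen vec_eq_7 su3_basis_mult_nth imul_nth e_i_def axis_def algebra_simps)
  show "rot_gen 3 6 4 5 \<in> kk"
    by (rule in_kk_if_cube)
      (simp_all add: transpose_rot_gen vec_eq_7 su3_basis_mult_nth imul_nth e_i_def axis_def algebra_simps)
  show "rot_gen 3 5 6 4 \<in> kk"
    by (rule in_kk_if_cube)
      (simp_all add: transpose_rot_gen vec_eq_7 su3_basis_mult_nth imul_nth e_i_def axis_def algebra_simps)
  show "rot_gen 1 2 4 3 \<in> kk"
    by (rule in_kk_if_cube)
      (simp_all add: transpose_rot_gen vec_eq_7 su3_basis_mult_nth imul_nth e_i_def axis_def algebra_simps)
  show "rot_gen 3 4 5 6 \<in> kk"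
    by (rule in_kk_if_cube)
      (simp_all add: transpose_rot_gen vec_eq_7 su3_basis_mult_nth imul_nth e_i_def axis_def algebra_simps)
qed

section \<open>The trace form, and linear equations for the Lie algebra of G2\<close>

lemma ip0_commute: "ip0 X Y = ip0 Y X"
  by (simp add: ip0_def trace_mul_sym[of X Y])

lemma bounded_bilinear_ip0: "bounded_bilinear ip0"
proof -
  have "linear (trace :: real^7^7 \<Rightarrow> real)"
    by (rule linearI) (simp_all add: trace_def sum.distrib sum_distrib_left)
  then have "bilinear ip0"
    unfolding bilinear_def ip0_def
    by (intro conjI allI linearI)
      (simp_all add: mm.add_left mm.add_right mm.scaleR_left mm.scaleR_right linear_add linear_scale)
  then show ?thesis by (simp add: bilinear_conv_bounded_bilinear)
qed

interpretation ip0: bounded_bilinear ip0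
  by (rule bounded_bilinear_ip0)

text \<open>Invariance of the trace form under the adjoint representation, from cyclicity of the
  trace.\<close>

lemma ip0_lbr: "ip0 (lbr X Y) Z = ip0 X (lbr Y Z)"
proof -
  have "trace (Y ** X ** Z) = trace (X ** (Z ** Y))"
    using trace_mul_sym[of Y "X ** Z"] by (simp add: matrix_mul_assoc)
  then show ?thesis
    unfolding lbr_def ip0.diff_left ip0.diff_right by (simp add: ip0_def matrix_mul_assoc)
qed

lemma ip0_eq_inner: assumes "transpose Y = - Y" shows "ip0 X Y = X \<bullet> Y"
proof -
  have "Y $ j $ i = - Y $ i $ j" for i j
    using arg_cong[OF assms, of "\<lambda>Z. Z $ i $ j"] by (simp add: transpose_def)
  then have "X $ i $ j * Y $ j $ i = - (X $ i $ j * Y $ i $ j)" for i j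
    by (metis mult_minus_right)
  then show ?thesis
    unfolding ip0_def trace_def matrix_matrix_mult_def inner_vec_def
    by (simp add: sum_negf)
qed

lemmas gg_skew = G2.lie_alg_skew[folded gg_def]
  and gg_lbr = G2.lie_alg_lbr[folded gg_def]
  and subspace_gg = G2.subspace_lie_alg[folded gg_def]
  and kk_lbr = K_grp.lie_alg_lbr[folded kk_def]
  and subspace_kk = K_grp.subspace_lie_alg[folded kk_def]

lemma gg_skew_nth: "X \<in> gg \<Longrightarrow> X $ j $ i = - X $ i $ j"
  using arg_cong[OF gg_skew[of X], of "\<lambda>Y. Y $ i $ j"] by (simp add: transpose_def)

lemma gg_diag: "X \<in> gg \<Longrightarrow> X $ i $ i = 0"
  using gg_skew_nth[of X i i] by simp

text \<open>The derivation rule on products of basis vectors, read off in single coordinates. These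
  seven equations cut the 14-dimensional Lie algebra of G2 out of the 21-dimensional space of skew
  matrices; each pair of indices occurs in exactly one of them.\<close>

lemma gg_linear_relations:
  assumes "X \<in> gg"
  shows
    "X$1$2 + X$3$4 - X$5$6 = 0"
    "X$2$0 + X$3$5 + X$4$6 = 0"
    "X$0$1 + X$3$6 - X$4$5 = 0"
    "X$4$0 + X$5$1 + X$6$2 = 0"
    "X$0$3 - X$1$6 + X$2$5 = 0"
    "X$1$3 + X$0$6 + X$4$2 = 0"
    "X$2$3 - X$0$5 + X$1$4 = 0"
proof -
  have deriv: "(X *v imul (axis p 1) (axis q 1)) $ r
      = (imul (X *v axis p 1) (axis q 1) + imul (axis p 1) (X *v axis q 1)) $ r" for p q r
    by (simp add: gg_derivation[OF assms])
  note entry = matrix_vector_mult_def sum_7 axis_def imul_nth gg_diag[OF assms]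
  show "X$1$2 + X$3$4 - X$5$6 = 0"
    using deriv[of 1 3 6]
    by (simp add: entry; use gg_skew_nth[OF assms, of 2 1] gg_skew_nth[OF assms, of 4 3] gg_skew_nth[OF assms, of 6 5] in linarith)
  show "X$2$0 + X$3$5 + X$4$6 = 0"
    using deriv[of 2 3 4]
    by (simp add: entry; use gg_skew_nth[OF assms, of 0 2] gg_skew_nth[OF assms, of 5 3] gg_skew_nth[OF assms, of 6 4] in linarith)
  show "X$0$1 + X$3$6 - X$4$5 = 0"
    using deriv[of 0 3 5]
    by (simp add: entry; use gg_skew_nth[OF assms, of 1 0] gg_skew_nth[OF assms, of 6 3] gg_skew_nth[OF assms, of 5 4] in linarith)
  show "X$4$0 + X$5$1 + X$6$2 = 0"
    using deriv[of 4 5 6]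
    by (simp add: entry; use gg_skew_nth[OF assms, of 0 4] gg_skew_nth[OF assms, of 1 5] gg_skew_nth[OF assms, of 2 6] in linarith)
  show "X$0$3 - X$1$6 + X$2$5 = 0"
    using deriv[of 0 1 5]
    by (simp add: entry; use gg_skew_nth[OF assms, of 3 0] gg_skew_nth[OF assms, of 6 1] gg_skew_nth[OF assms, of 5 2] in linarith)
  show "X$1$3 + X$0$6 + X$4$2 = 0"
    using deriv[of 1 0 4]
    by (simp add: entry; use gg_skew_nth[OF assms, of 3 1] gg_skew_nth[OF assms, of 6 0] gg_skew_nth[OF assms, of 2 4] in linarith)
  show "X$2$3 - X$0$5 + X$1$4 = 0"
    using deriv[of 2 0 4]
    by (simp add: entry; use gg_skew_nth[OF assms, of 3 2] gg_skew_nth[OF assms, of 5 0] gg_skew_nth[OF assms, of 4 1] in linarith)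
qed

section \<open>The complement of su(3) and its brackets\<close>

definition pp :: "(real^7^7) set" where
  "pp = {X \<in> gg. \<forall>J\<in>kk. ip0 X J = 0}"

lemma subspace_pp: "subspace pp"
  using subspace_gg
  by (auto simp: pp_def subspace_def ip0.add_left ip0.scaleR_left ip0.zero_left)

lemma ip0_rot_gen: assumes "X \<in> gg" shows "ip0 X (rot_gen a b c d) = 2 * (X $ b $ a + X $ d $ c)"
proof -
  have entry: "y * (if i = q \<and> j = p then 1 else 0) = (if j = p then if i = q then y else 0 else 0)"
    for i j p q :: 7 and y :: real by simp
  have "X \<bullet> rot_gen a b c d = X $ b $ a - X $ a $ b + X $ d $ c - X $ c $ d"
    by (simp add: inner_vec_def rot_gen_def right_diff_distrib distrib_left entry sum.distrib sum_subtractf)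
  then show ?thesis
    using gg_skew_nth[OF assms, of b a] gg_skew_nth[OF assms, of d c]
    by (simp add: ip0_eq_inner transpose_rot_gen)
qed

text \<open>The complement \<open>\<frak>p\<close> is parametrised by the first column: the relations of the Lie algebra and
  orthogonality to \<open>\<frak>s\<frak>u(3)\<close> determine all other entries.\<close>

lemma pp_entries:
  assumes "X \<in> pp"
  shows "X$1$2 = 0" "X$3$4 = 0" "X$5$6 = 0"
    "X$3$5 = - X$2$0 / 2" "X$4$6 = - X$2$0 / 2"
    "X$3$6 = X$1$0 / 2" "X$4$5 = - X$1$0 / 2"
    "X$1$5 = X$4$0 / 2" "X$2$6 = X$4$0 / 2"
    "X$1$6 = - X$3$0 / 2" "X$2$5 = X$3$0 / 2"
    "X$1$3 = X$6$0 / 2" "X$2$4 = - X$6$0 / 2"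
    "X$1$4 = - X$5$0 / 2" "X$2$3 = - X$5$0 / 2"
proof -
  have X: "X \<in> gg" using assms by (simp add: pp_def)
  have "\<forall>J\<in>su3_basis. ip0 X J = 0"
    using assms su3_basis_subset_kk by (auto simp: pp_def)
  then have orth: "X$3$1 + X$4$2 = 0" "X$4$1 + X$2$3 = 0" "X$6$1 + X$5$2 = 0" "X$5$1 + X$2$6 = 0"
     "X$6$3 + X$5$4 = 0" "X$5$3 + X$4$6 = 0" "X$2$1 + X$3$4 = 0" "X$4$3 + X$6$5 = 0"
    by (simp_all add: su3_basis_def ip0_rot_gen[OF X])
  note rel = gg_linear_relations[OF X]
  show "X$1$2 = 0" "X$3$4 = 0" "X$5$6 = 0"
    using rel(1) orth(7) orth(8) gg_skew_nth[OF X, of 2 1] gg_skew_nth[OF X, of 4 3] gg_skew_nth[OF X, of 6 5]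
    by linarith+
  show "X$3$5 = - X$2$0 / 2" "X$4$6 = - X$2$0 / 2"
    using rel(2) orth(6) gg_skew_nth[OF X, of 5 3] gg_skew_nth[OF X, of 6 4]
    by linarith+
  show "X$3$6 = X$1$0 / 2" "X$4$5 = - X$1$0 / 2"
    using rel(3) orth(5) gg_skew_nth[OF X, of 6 3] gg_skew_nth[OF X, of 5 4] gg_skew_nth[OF X, of 0 1]
    by linarith+
  show "X$1$5 = X$4$0 / 2" "X$2$6 = X$4$0 / 2"
    using rel(4) orth(4) gg_skew_nth[OF X, of 5 1] gg_skew_nth[OF X, of 6 2]
    by linarith+
  show "X$1$6 = - X$3$0 / 2" "X$2$5 = X$3$0 / 2"
    using rel(5) orth(3) gg_skew_nth[OF X, of 6 1] gg_skew_nth[OF X, of 5 2] gg_skew_nth[OF X, of 0 3]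
    by linarith+
  show "X$1$3 = X$6$0 / 2" "X$2$4 = - X$6$0 / 2"
    using rel(6) orth(1) gg_skew_nth[OF X, of 3 1] gg_skew_nth[OF X, of 4 2] gg_skew_nth[OF X, of 0 6]
    by linarith+
  show "X$1$4 = - X$5$0 / 2" "X$2$3 = - X$5$0 / 2"
    using rel(7) orth(2) gg_skew_nth[OF X, of 4 1] gg_skew_nth[OF X, of 3 2] gg_skew_nth[OF X, of 0 5]
    by linarith+
qed

lemma mult_e_i_nth: "(X *v e_i) $ k = X $ k $ 0"
  by (simp add: e_i_def matrix_vector_mult_basis column_def)

text \<open>Up to the factor 3, evaluation at \<open>e_i\<close> is an isometry of \<open>pp\<close>
  into the tangent space of the six-sphere at i, so elements of \<open>pp\<close> can be handled
  through their first columns.\<close>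

lemma ip0_pp: assumes "X \<in> pp" "Y \<in> pp" shows "ip0 X Y = 3 * ((X *v e_i) \<bullet> (Y *v e_i))"
proof -
  have X: "X \<in> gg" and Y: "Y \<in> gg" using assms by (simp_all add: pp_def)
  define f where "f i j = X $ i $ j * Y $ i $ j" for i j
  have f: "f i j = f j i" "f i i = 0" for i j
    using gg_skew_nth[OF X, of i j] gg_skew_nth[OF Y, of i j] gg_diag[OF X] by (simp_all add: f_def)
  have "ip0 X Y = (\<Sum>i\<in>UNIV. \<Sum>j\<in>UNIV. f i j)"
    by (simp add: ip0_eq_inner gg_skew[OF Y] inner_vec_def f_def)
  also have "\<dots> = 2 * (f 1 0 + f 2 0 + f 3 0 + f 4 0 + f 5 0 + f 6 0 + f 1 2 + f 1 3 + f 1 4 + f 1 5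
      + f 1 6 + f 2 3 + f 2 4 + f 2 5 + f 2 6 + f 3 4 + f 3 5 + f 3 6 + f 4 5 + f 4 6 + f 5 6)"
    unfolding sum_7
    using f(1)[of 0 1] f(1)[of 0 2] f(1)[of 0 3] f(1)[of 0 4] f(1)[of 0 5] f(1)[of 0 6]
      f(1)[of 2 1] f(1)[of 3 1] f(1)[of 3 2] f(1)[of 4 1] f(1)[of 4 2] f(1)[of 4 3]
      f(1)[of 5 1] f(1)[of 5 2] f(1)[of 5 3] f(1)[of 5 4] f(1)[of 6 1] f(1)[of 6 2] f(1)[of 6 3]
      f(1)[of 6 4] f(1)[of 6 5] f(2)
    by simp
  \<comment> \<open>Each entry of the first column recurs, halved up to sign, in two other entries;
    the factor is 2 (1 + 1/4 + 1/4) = 3.\<close>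
  also have "\<dots> = 3 * (f 1 0 + f 2 0 + f 3 0 + f 4 0 + f 5 0 + f 6 0)"
    unfolding f_def pp_entries[OF assms(1)] pp_entries[OF assms(2)] by simp
  also have "\<dots> = 3 * ((X *v e_i) \<bullet> (Y *v e_i))"
    using f(2)[of 0] by (simp add: inner_vec_def sum_7 mult_e_i_nth f_def)
  finally show ?thesis .
qed

lemma pp_eq_0: assumes "X \<in> pp" "X *v e_i = 0" shows "X = 0"
  using ip0_pp[OF assms(1,1)] assms ip0_eq_inner[of X X] gg_skew[of X]
  by (simp add: pp_def)

text \<open>Invariance of \<open>ip0\<close> moves the bracket with \<open>J\<close> onto the test
  element, and \<open>kk\<close> is closed under brackets.\<close>

lemma lbr_pp_kk: assumes "X \<in> pp" "J \<in> kk" shows "lbr X J \<in> pp"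
proof -
  have "J \<in> gg" using assms(2) kk_subset_gg by blast
  with assms show ?thesis by (simp add: pp_def ip0_lbr gg_lbr kk_lbr)
qed

text \<open>The hypotheses say that \<open>v w\<^sup>* - w v\<^sup>*\<close>, for \<open>v, w \<in> \<complex>\<^sup>3\<close>, is a scalar matrix; having rank
  at most two it vanishes.\<close>

lemma su3_orthogonal_imp_dependent:
  fixes v w :: "real^7"
  assumes "v $ 0 = 0" "w $ 0 = 0" and J: "\<And>J. J \<in> su3_basis \<Longrightarrow> v \<bullet> (J *v w) = 0"
  shows "(w \<bullet> w) *\<^sub>R v = (v \<bullet> w) *\<^sub>R w"
proof -
  define a1 a2 a3 where "a1 = Complex (v$1) (v$2)" and "a2 = Complex (v$3) (v$4)" and "a3 = Complex (v$6) (v$5)"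
  define b1 b2 b3 where "b1 = Complex (w$1) (w$2)" and "b2 = Complex (w$3) (w$4)" and "b3 = Complex (w$6) (w$5)"
  note ab = a1_def a2_def a3_def b1_def b2_def b3_def
  have eqs: "v$3*w$1 - v$1*w$3 + v$4*w$2 - v$2*w$4 = 0" "v$4*w$1 - v$1*w$4 + v$2*w$3 - v$3*w$2 = 0"
    "v$6*w$1 - v$1*w$6 + v$5*w$2 - v$2*w$5 = 0" "v$5*w$1 - v$1*w$5 + v$2*w$6 - v$6*w$2 = 0"
    "v$6*w$3 - v$3*w$6 + v$5*w$4 - v$4*w$5 = 0" "v$5*w$3 - v$3*w$5 + v$4*w$6 - v$6*w$4 = 0"
    "v$2*w$1 - v$1*w$2 + v$3*w$4 - v$4*w$3 = 0" "v$4*w$3 - v$3*w$4 + v$6*w$5 - v$5*w$6 = 0"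
    using J[of "rot_gen 1 3 2 4"] J[of "rot_gen 1 4 3 2"] J[of "rot_gen 1 6 2 5"] J[of "rot_gen 1 5 6 2"]
      J[of "rot_gen 3 6 4 5"] J[of "rot_gen 3 5 6 4"] J[of "rot_gen 1 2 4 3"] J[of "rot_gen 3 4 5 6"]
    by (simp_all add: su3_basis_def inner_vec_def sum_7 su3_basis_mult_nth)
  have off: "a1 * cnj b2 - b1 * cnj a2 = 0" "a2 * cnj b1 - b2 * cnj a1 = 0"
    "a1 * cnj b3 - b1 * cnj a3 = 0" "a3 * cnj b1 - b3 * cnj a1 = 0"
    "a2 * cnj b3 - b2 * cnj a3 = 0" "a3 * cnj b2 - b3 * cnj a2 = 0"
    using eqs(1-6) by (simp_all add: ab complex_eq_iff algebra_simps)
  have diag: "a2 * cnj b2 - b2 * cnj a2 = a1 * cnj b1 - b1 * cnj a1"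
    "a3 * cnj b3 - b3 * cnj a3 = a1 * cnj b1 - b1 * cnj a1"
    using eqs(7,8) by (simp_all add: ab complex_eq_iff algebra_simps)
  \<comment> \<open>The determinant of the 3 by 3 matrix with entries
    \<open>x_i y_j' - y_i x_j'\<close>, which has rank at most two.\<close>
  have det3: "(x1*y1'-y1*x1')*(x2*y2'-y2*x2')*(x3*y3'-y3*x3')
     + (x1*y2'-y1*x2')*(x2*y3'-y2*x3')*(x3*y1'-y3*x1')
     + (x1*y3'-y1*x3')*(x2*y1'-y2*x1')*(x3*y2'-y3*x2')
     - (x1*y1'-y1*x1')*(x2*y3'-y2*x3')*(x3*y2'-y3*x2')
     - (x1*y2'-y1*x2')*(x2*y1'-y2*x1')*(x3*y3'-y3*x3')
     - (x1*y3'-y1*x3')*(x2*y2'-y2*x2')*(x3*y1'-y3*x1') = 0"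
    for x1 x2 x3 y1 y2 y3 x1' x2' x3' y1' y2' y3' :: complex
    by algebra
  \<comment> \<open>By \<open>off\<close> and \<open>diag\<close> the matrix is scalar, so its
    determinant is the cube of a diagonal entry.\<close>
  have "(a1 * cnj b1 - b1 * cnj a1) * (a1 * cnj b1 - b1 * cnj a1) * (a1 * cnj b1 - b1 * cnj a1) = 0"
    using det3[of a1 "cnj b1" b1 "cnj a1" a2 "cnj b2" b2 "cnj a2" a3 "cnj b3" b3 "cnj a3"]
    by (simp only: off diag) simp
  then have "a1 * cnj b1 - b1 * cnj a1 = 0" by simp
  with diag have d: "a1 * cnj b1 - b1 * cnj a1 = 0" "a2 * cnj b2 - b2 * cnj a2 = 0" "a3 * cnj b3 - b3 * cnj a3 = 0"
    by simp_all
  define p where "p = cnj a1 * b1 + cnj a2 * b2 + cnj a3 * b3"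
  define q where "q = cnj b1 * b1 + cnj b2 * b2 + cnj b3 * b3"
  \<comment> \<open>Apply the vanishing matrix to the vector b: \<open>q\<close> is the squared norm
    of b and \<open>p\<close> the Hermitian product of a and b.\<close>
  have "q * a1 = p * b1" "q * a2 = p * b2" "q * a3 = p * b3"
    unfolding p_def q_def using d off by algebra+
  moreover have "q = of_real (w \<bullet> w)"
    using assms(2) by (simp add: q_def ab complex_eq_iff inner_vec_def sum_7)
  \<comment> \<open>The vanishing diagonal makes each summand of \<open>p\<close> real.\<close>
  moreover have "p = of_real (v \<bullet> w)"
    using assms(1) d by (simp add: p_def ab complex_eq_iff inner_vec_def sum_7 algebra_simps)
  ultimately show ?thesis
    using assms(1,2) by (simp add: ab complex_eq_iff vec_eq_7)
qed

text \<open>Geometrically: \<open>G\<^sub>2/SU(3)\<close> is the round sphere \<open>S\<^sup>6\<close>, on which \<open>SU(3)\<close> acts transitively on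
  unit tangent vectors.\<close>

lemma lbr_pp_eq_0:
  assumes a: "a \<in> pp" and b: "b \<in> pp" and orth: "\<And>J. J \<in> kk \<Longrightarrow> ip0 (lbr a b) J = 0"
  shows "lbr a b = 0"
proof -
  define v w where "v = a *v e_i" and "w = b *v e_i"
  have "v \<bullet> (J *v w) = 0" if "J \<in> su3_basis" for J
  proof -
    have J: "J \<in> kk" using that su3_basis_subset_kk by blast
    have "lbr b J *v e_i = - (J *v w)"
      using kk_e_i[OF J] by (simp add: lbr_def w_def mv.diff_left flip: matrix_vector_mul_assoc)
    \<comment> \<open>Invariance turns the left side into the product of \<open>a\<close> with
      \<open>lbr b J\<close>; both lie in \<open>pp\<close>, so their first columns determine
      it.\<close>
    then have "ip0 (lbr a b) J = - 3 * (v \<bullet> (J *v w))"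
      using ip0_pp[OF a lbr_pp_kk[OF b J]] by (simp add: ip0_lbr v_def)
    then show ?thesis using orth[OF J] by simp
  qed
  moreover have "v $ 0 = 0" "w $ 0 = 0"
    using a b gg_diag by (auto simp: v_def w_def mult_e_i_nth pp_def)
  ultimately have "(w \<bullet> w) *\<^sub>R v = (v \<bullet> w) *\<^sub>R w"
    by (intro su3_orthogonal_imp_dependent)
  then have "((w \<bullet> w) *\<^sub>R a - (v \<bullet> w) *\<^sub>R b) *v e_i = 0"
    by (simp add: mv.diff_left mv.scaleR_left v_def w_def)
  moreover have "(w \<bullet> w) *\<^sub>R a - (v \<bullet> w) *\<^sub>R b \<in> pp"
    using a b subspace_pp by (intro subspace_diff subspace_scale)
  ultimately have eq: "(w \<bullet> w) *\<^sub>R a = (v \<bullet> w) *\<^sub>R b"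
    using pp_eq_0 by fastforce
  show ?thesis
  proof (cases "w = 0")
    case True
    then have "b = 0" using pp_eq_0[OF b] by (simp add: w_def)
    then show ?thesis by (simp add: lbr_def)
  next
    case False
    then have "a = (1 / (w \<bullet> w)) *\<^sub>R ((w \<bullet> w) *\<^sub>R a)" by simp
    also have "\<dots> = ((v \<bullet> w) / (w \<bullet> w)) *\<^sub>R b" unfolding eq by simp
    finally have "a = ((v \<bullet> w) / (w \<bullet> w)) *\<^sub>R b" .
    then show ?thesis by (simp add: lbr_def mm.scaleR_left mm.scaleR_right)
  qed
qed

subsection \<open>The projection onto \<open>\<frak>k\<close> and the metric\<close>

lemma ip0_self_eq_0: assumes "X \<in> gg" shows "ip0 X X = 0 \<longleftrightarrow> X = 0"
  by (simp add: ip0_eq_inner gg_skew[OF assms])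

lemma ip0_self_nonneg: assumes "X \<in> gg" shows "0 \<le> ip0 X X"
  by (simp add: ip0_eq_inner gg_skew[OF assms])

lemma ip0_kk_nondegenerate:
  assumes "Y \<in> kk" "\<And>Z. Z \<in> kk \<Longrightarrow> ip0 Y Z = 0" shows "Y = 0"
  using assms ip0_self_eq_0[of Y] kk_subset_gg by blast

lemma kpart_unique:
  assumes "Y \<in> kk" "\<And>Z. Z \<in> kk \<Longrightarrow> ip0 (X - Y) Z = 0" shows "kpart X = Y"
  unfolding kpart_def
proof (rule the_equality)
  fix Y' assume Y': "Y' \<in> kk \<and> (\<forall>Z\<in>kk. ip0 (X - Y') Z = 0)"
  have "ip0 (Y' - Y) Z = 0" if "Z \<in> kk" for Z
    using Y' assms(2)[OF that] that by (simp add: ip0.diff_left)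
  moreover have "Y' - Y \<in> kk" using Y' assms(1) subspace_kk subspace_diff by blast
  ultimately show "Y' = Y" using ip0_kk_nondegenerate by fastforce
qed (use assms in blast)

text \<open>The Euclidean orthogonal projection onto \<open>kk\<close> serves, because
  \<open>ip0\<close> agrees with the Euclidean product as soon as its second argument is skew. Hence
  \<open>kpart\<close> is well defined on all matrices.\<close>

lemma kpart_in_kk: "kpart X \<in> kk"
  and ip0_minus_kpart: "Z \<in> kk \<Longrightarrow> ip0 (X - kpart X) Z = 0"
proof -
  have span: "span kk = kk" using subspace_kk span_eq_iff by blast
  obtain y z where yz: "y \<in> span kk" "\<And>w. w \<in> span kk \<Longrightarrow> orthogonal z w" "X = y + z"
    using orthogonal_subspace_decomp_exists by blast
  have "ip0 z Z = 0" if "Z \<in> kk" for Z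
    using yz(2)[of Z] that kk_subset_gg gg_skew[of Z]
    by (auto simp: span ip0_eq_inner orthogonal_def)
  then have "kpart X = y"
    using yz by (intro kpart_unique) (simp_all add: span)
  with yz \<open>\<And>Z. Z \<in> kk \<Longrightarrow> ip0 z Z = 0\<close>
  show "kpart X \<in> kk" "Z \<in> kk \<Longrightarrow> ip0 (X - kpart X) Z = 0"
    by (simp_all add: span)
qed

lemma kpart_in_gg: "kpart X \<in> gg"
  using kpart_in_kk kk_subset_gg by blast

lemma ppart_in_pp: "X \<in> gg \<Longrightarrow> ppart X \<in> pp"
  by (simp add: pp_def ppart_def ip0_minus_kpart subspace_diff[OF subspace_gg] kpart_in_gg)

lemma kpart_plus_ppart: "kpart X + ppart X = X"
  by (simp add: ppart_def)

lemma ip0_kpart_right: "ip0 X (kpart Y) = ip0 (kpart X) (kpart Y)"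
  using ip0_minus_kpart[OF kpart_in_kk, of X Y] by (simp add: ip0.diff_left)

lemma linear_kpart: "linear kpart"
proof (rule linearI)
  fix X Y :: "real^7^7" and r :: real
  show "kpart (X + Y) = kpart X + kpart Y"
  proof (rule kpart_unique)
    show "kpart X + kpart Y \<in> kk" by (simp add: subspace_add[OF subspace_kk] kpart_in_kk)
    show "ip0 (X + Y - (kpart X + kpart Y)) Z = 0" if "Z \<in> kk" for Z
      using ip0_minus_kpart[OF that, of X] ip0_minus_kpart[OF that, of Y]
      by (simp add: ip0.diff_left ip0.add_left)
  qed
  show "kpart (r *\<^sub>R X) = r *\<^sub>R kpart X"
  proof (rule kpart_unique)
    show "r *\<^sub>R kpart X \<in> kk" by (simp add: subspace_scale[OF subspace_kk] kpart_in_kk)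
    show "ip0 (r *\<^sub>R X - r *\<^sub>R kpart X) Z = 0" if "Z \<in> kk" for Z
      using ip0_minus_kpart[OF that, of X]
      by (simp add: ip0.diff_left ip0.scaleR_left)
  qed
qed

lemma kpart_kk_plus_pp: assumes "x \<in> kk" "a \<in> pp" shows "kpart (x + a) = x" "ppart (x + a) = a"
proof -
  show "kpart (x + a) = x"
    using assms by (intro kpart_unique) (auto simp: pp_def)
  then show "ppart (x + a) = a" by (simp add: ppart_def)
qed

lemma gg_decompose: assumes "X \<in> gg" obtains x a where "x \<in> kk" "a \<in> pp" "X = x + a"
  using that kpart_in_kk ppart_in_pp[OF assms] kpart_plus_ppart by metis

lemma ip0_pp_kk: "a \<in> pp \<Longrightarrow> x \<in> kk \<Longrightarrow> ip0 a x = 0" "a \<in> pp \<Longrightarrow> x \<in> kk \<Longrightarrow> ip0 x a = 0"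
  by (simp_all add: pp_def ip0_commute[of x])

lemma pp_subset_gg: "pp \<subseteq> gg"
  by (auto simp: pp_def)

lemma lbr_commute: "lbr Y X = - lbr X Y"
  by (simp add: lbr_def)

lemma bounded_bilinear_lbr: "bounded_bilinear lbr"
proof -
  have "bilinear lbr"
    unfolding bilinear_def lbr_def
    by (intro conjI allI linearI)
      (simp_all add: mm.add_left mm.add_right mm.scaleR_left mm.scaleR_right algebra_simps)
  then show ?thesis by (simp add: bilinear_conv_bounded_bilinear)
qed

interpretation lbr: bounded_bilinear lbr
  by (rule bounded_bilinear_lbr)

lemma lbr_kk_pp: assumes "x \<in> kk" "a \<in> pp" shows "lbr x a \<in> pp"
  using subspace_neg[OF subspace_pp lbr_pp_kk[OF assms(2,1)]] lbr_commute[of x a] by simp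

lemma lbr_jacobi: "lbr X (lbr Y Z) + lbr Y (lbr Z X) + lbr Z (lbr X Y) = 0"
  by (simp add: lbr_def mm.diff_left mm.diff_right matrix_mul_assoc)

section \<open>The deformed metric\<close>

lemma phi_kk_plus_pp: "x \<in> kk \<Longrightarrow> a \<in> pp \<Longrightarrow> phi t (x + a) = (t / (t + 1)) *\<^sub>R x + a"
  by (simp add: phi_def kpart_kk_plus_pp)

lemma phi_in_gg: assumes "X \<in> gg" shows "phi t X \<in> gg"
proof -
  have "ppart X \<in> gg" using ppart_in_pp[OF assms] pp_subset_gg by blast
  then show ?thesis
    by (simp add: phi_def subspace_add[OF subspace_gg] subspace_scale[OF subspace_gg] kpart_in_gg)
qed

lemma linear_phi: "linear (phi t)"
  by (rule linearI) (simp_all add: phi_def ppart_def linear_add[OF linear_kpart] linear_scale[OF linear_kpart]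
    algebra_simps)

lemma bounded_bilinear_ip1: "bounded_bilinear (ip1 t)"
proof -
  have "bilinear (ip1 t)"
    unfolding bilinear_def ip1_def
    by (intro conjI allI linearI)
      (simp_all add: ip0.add_left ip0.add_right ip0.scaleR_left ip0.scaleR_right
        linear_add[OF linear_phi] linear_scale[OF linear_phi])
  then show ?thesis by (simp add: bilinear_conv_bounded_bilinear)
qed

text \<open>\<open>phi t\<close> is the identity plus a multiple of the orthogonal projection
  \<open>kpart\<close>, hence self-adjoint.\<close>

lemma ip1_commute: "ip1 t X Y = ip1 t Y X"
proof -
  have "ip0 X (phi t Y) = ip0 X Y + (t / (t + 1) - 1) * ip0 (kpart X) (kpart Y)" for X Y
    by (simp add: phi_def ppart_def ip0.add_right ip0.diff_right ip0.scaleR_right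
        ip0_kpart_right[of X] algebra_simps)
  then show ?thesis
    by (simp add: ip1_def ip0_commute[of X] ip0_commute[of "kpart X"])
qed

lemma ip1_kk_plus_pp:
  assumes "x \<in> kk" "y \<in> kk" "a \<in> pp" "b \<in> pp"
  shows "ip1 t (x + a) (y + b) = t / (t + 1) * ip0 x y + ip0 a b"
  using assms by (simp add: ip1_def phi_kk_plus_pp ip0.add_left ip0.add_right ip0.scaleR_right ip0_pp_kk)

lemma ip1_pos:
  assumes "X \<in> gg" "X \<noteq> 0" "t > 0" shows "ip1 t X X > 0"
proof -
  obtain x a where xa: "x \<in> kk" "a \<in> pp" "X = x + a" using gg_decompose[OF assms(1)] .
  have g: "x \<in> gg" "a \<in> gg" using xa kk_subset_gg pp_subset_gg by auto
  have "x \<noteq> 0 \<or> a \<noteq> 0" using xa assms by auto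
  then have "ip0 x x > 0 \<or> ip0 a a > 0"
    using ip0_self_eq_0[OF g(1)] ip0_self_eq_0[OF g(2)] ip0_self_nonneg[OF g(1)] ip0_self_nonneg[OF g(2)]
    by linarith
  moreover have "t / (t + 1) > 0" using assms by simp
  ultimately have "t / (t + 1) * ip0 x x + ip0 a a > 0"
    using ip0_self_nonneg[OF g(1)] ip0_self_nonneg[OF g(2)]
    by (metis add_nonneg_pos add_pos_nonneg mult_nonneg_nonneg mult_pos_pos less_imp_le)
  then show ?thesis using xa by (simp add: ip1_kk_plus_pp)
qed

subsection \<open>The Levi-Civita connection and the curvature\<close>

text \<open>Closed form of the Levi-Civita connection of \<open>ip1 t\<close> on left-invariant
  fields: half the bracket, as for a bi-invariant metric, plus a \<open>pp\<close>-valued correction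
  on \<open>gg\<close>.\<close>

definition nab :: "real \<Rightarrow> real^7^7 \<Rightarrow> real^7^7 \<Rightarrow> real^7^7" where
  "nab t X Y = (1/2) *\<^sub>R (lbr X Y + (1 / (t + 1)) *\<^sub>R (lbr (kpart X) (ppart Y) - lbr (ppart X) (kpart Y)))"

definition Rm :: "real \<Rightarrow> real^7^7 \<Rightarrow> real^7^7 \<Rightarrow> real^7^7 \<Rightarrow> real^7^7" where
  "Rm t X Y Z = nab t X (nab t Y Z) - nab t Y (nab t X Z) - nab t (lbr X Y) Z"

lemma nab_in_gg: assumes "X \<in> gg" "Y \<in> gg" shows "nab t X Y \<in> gg"
proof -
  have "ppart X \<in> gg" "ppart Y \<in> gg" using assms ppart_in_pp pp_subset_gg by auto
  then show ?thesis
    unfolding nab_def using assms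
    by (intro subspace_scale[OF subspace_gg] subspace_add[OF subspace_gg] subspace_diff[OF subspace_gg]
      gg_lbr kpart_in_gg)
qed

text \<open>By invariance the last two terms combine to the product of \<open>Z\<close> with
  \<open>lbr X (phi t Y) - lbr (phi t X) Y\<close>. As \<open>phi t\<close> is the identity minus
  \<mu> times the projection to \<open>kk\<close>, this difference is \<mu> times the correction
  \<open>d\<close> in \<open>nab\<close>, and \<open>phi t\<close> fixes \<open>d\<close> because
  \<open>d\<close> lies in \<open>pp\<close>.\<close>

lemma koszul:
  assumes t: "t > 0" and X: "X \<in> gg" and Y: "Y \<in> gg" and Z: "Z \<in> gg"
  shows "ip1 t (nab t X Y) Z = (1/2) * (ip1 t (lbr X Y) Z - ip1 t (lbr Y Z) X + ip1 t (lbr Z X) Y)"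
proof -
  obtain x a where xa: "x \<in> kk" "a \<in> pp" "X = x + a" using gg_decompose[OF X] .
  obtain y b where yb: "y \<in> kk" "b \<in> pp" "Y = y + b" using gg_decompose[OF Y] .
  define \<mu> where "\<mu> = 1 / (t + 1)"
  have lam: "t / (t + 1) = 1 - \<mu>" using t by (simp add: \<mu>_def field_simps)
  define d where "d = lbr x b - lbr a y"
  have d: "d \<in> pp"
    unfolding d_def using xa yb by (intro subspace_diff[OF subspace_pp] lbr_kk_pp lbr_pp_kk)
  have nab: "nab t X Y = (1/2) *\<^sub>R (lbr X Y + \<mu> *\<^sub>R d)"
    by (simp add: nab_def xa(3) yb(3) kpart_kk_plus_pp xa(1,2) yb(1,2) \<mu>_def d_def)
  have phid: "phi t d = d"
    using phi_kk_plus_pp[OF _ d, of 0 t] subspace_0[OF subspace_kk] by simp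
  have phi: "phi t X = X - \<mu> *\<^sub>R x" "phi t Y = Y - \<mu> *\<^sub>R y"
    unfolding xa(3) yb(3) phi_kk_plus_pp[OF xa(1,2)] phi_kk_plus_pp[OF yb(1,2)] lam
    by (simp_all add: algebra_simps)
  have "ip1 t d Z = ip0 Z d"
    using ip1_commute[of t d Z] by (simp add: ip1_def phid)
  moreover have "ip1 t (lbr Y Z) X = ip0 Z (lbr (phi t X) Y)"
    using ip0_lbr[of "phi t X" Y Z] by (simp add: ip1_def ip0_commute[of _ "phi t X"] ip0_commute[of Z])
  moreover have "ip1 t (lbr Z X) Y = ip0 Z (lbr X (phi t Y))"
    by (simp add: ip1_def ip0_lbr)
  moreover have "lbr X (phi t Y) - lbr (phi t X) Y = \<mu> *\<^sub>R d"
    unfolding phi d_def unfolding xa(3) yb(3)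
    by (simp add: lbr.add_left lbr.add_right lbr.diff_left lbr.diff_right lbr.scaleR_left lbr.scaleR_right
        algebra_simps)
  then have "ip0 Z (lbr X (phi t Y)) - ip0 Z (lbr (phi t X) Y) = \<mu> * ip0 Z d"
    by (metis ip0.diff_right ip0.scaleR_right real_scaleR_def)
  moreover have "ip1 t (nab t X Y) Z = (1/2) * (ip1 t (lbr X Y) Z + \<mu> * ip1 t d Z)"
    unfolding nab
    by (simp add: bounded_bilinear.add_left[OF bounded_bilinear_ip1] bounded_bilinear.scaleR_left[OF bounded_bilinear_ip1])
  ultimately show ?thesis by simp
qed

text \<open>Metric compatibility: exchanging \<open>Y\<close> and \<open>Z\<close> reverses the sign
  of the right side of the Koszul formula.\<close>

lemma ip1_nab_skew:
  assumes "t > 0" "X \<in> gg" "Y \<in> gg" "Z \<in> gg"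
  shows "ip1 t (nab t X Y) Z = - ip1 t (nab t X Z) Y"
  using koszul[OF assms] koszul[OF assms(1,2,4,3)] lbr_commute[of X Y] lbr_commute[of X Z] lbr_commute[of Y Z]
  by (simp add: bounded_bilinear.minus_left[OF bounded_bilinear_ip1])

text \<open>Obtained from the Koszul formula by completing squares separately in the \<open>\<frak>p\<close>- and the
  \<open>\<frak>k\<close>-components.\<close>

lemma curvature_sum_of_squares:
  assumes t: "t > 0" and xy: "x \<in> kk" "y \<in> kk" and ab: "a \<in> pp" "b \<in> pp"
    and \<mu>: "\<mu> = 1 / (t + 1)" and r: "r = kpart (lbr a b)" and q: "q = ppart (lbr a b)"
    and u: "u = lbr x y" and m: "m = lbr x b + lbr a y"
  shows "4 * ip1 t (Rm t (x + a) (y + b) (y + b)) (x + a) =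
    ip0 ((1 - \<mu>) *\<^sub>R m + q) ((1 - \<mu>) *\<^sub>R m + q)
    + (1 - \<mu>) * ip0 (u + (1 + 2 * \<mu>) *\<^sub>R r) (u + (1 + 2 * \<mu>) *\<^sub>R r) + 4 * \<mu> ^ 3 * ip0 r r"
proof -
  interpret ip1: bounded_bilinear "ip1 t" by (rule bounded_bilinear_ip1)
  have lam: "t / (t + 1) = 1 - \<mu>" using t by (simp add: \<mu> field_simps)
  define X Y where "X = x + a" and "Y = y + b"
  have XY: "X \<in> gg" "Y \<in> gg"
    using xy ab kk_subset_gg pp_subset_gg by (auto simp: X_def Y_def intro!: subspace_add[OF subspace_gg])
  define m1 m2 where "m1 = lbr x b" and "m2 = lbr a y"
  have mm: "m = m1 + m2" by (simp add: m m1_def m2_def)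
  have k: "u \<in> kk" "r \<in> kk" using xy by (simp_all add: u r kk_lbr kpart_in_kk)
  have "lbr a b \<in> gg" using ab pp_subset_gg gg_lbr by blast
  then have p: "q \<in> pp" "m1 \<in> pp" "m2 \<in> pp"
    using xy ab by (simp_all add: q ppart_in_pp m1_def m2_def lbr_kk_pp lbr_pp_kk)
  define B where "B = (u + r) + (q + m1 + m2)"
  have B: "lbr X Y = B"
    using kpart_plus_ppart[of "lbr a b"]
    by (simp add: X_def Y_def B_def lbr.add_left lbr.add_right u r q m1_def m2_def algebra_simps)
  have parts: "kpart X = x" "ppart X = a" "kpart Y = y" "ppart Y = b"
    using xy ab by (simp_all add: X_def Y_def kpart_kk_plus_pp)
  have half: "(1/2) *\<^sub>R (\<mu> *\<^sub>R (z - - z)) = \<mu> *\<^sub>R z" for z :: "real^7^7"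
    by (metis diff_minus_eq_add scaleR_half_double scaleR_left_commute)
  have nab_self: "nab t X X = 0 + \<mu> *\<^sub>R lbr x a" "nab t Y Y = 0 + \<mu> *\<^sub>R lbr y b"
    unfolding nab_def parts \<mu>[symmetric] lbr_commute[of a x] lbr_commute[of b y]
    using half by (simp_all add: lbr_def[of X X] lbr_def[of Y Y])
  have nab_XY: "nab t X Y = (1/2) *\<^sub>R (u + r) + (1/2) *\<^sub>R (q + m1 + m2 + \<mu> *\<^sub>R (m1 - m2))"
    unfolding nab_def parts B \<mu>[symmetric] m1_def[symmetric] m2_def[symmetric] B_def
    by (simp add: algebra_simps)
  have nab_YX: "nab t Y X = (- 1/2) *\<^sub>R (u + r) + (1/2) *\<^sub>R (- (q + m1 + m2) + \<mu> *\<^sub>R (m1 - m2))"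
    unfolding nab_def parts lbr_commute[of Y X] lbr_commute[of y a] lbr_commute[of b x]
      B \<mu>[symmetric] m1_def[symmetric] m2_def[symmetric] B_def
    by (simp add: algebra_simps)
  have zero: "0 \<in> kk" using subspace_0[OF subspace_kk] .
  have in_pp: "s *\<^sub>R lbr x a \<in> pp" "s *\<^sub>R lbr y b \<in> pp" for s
    using xy ab by (simp_all add: lbr_kk_pp subspace_scale[OF subspace_pp])
  have T1: "ip1 t (nab t Y Y) (nab t X X) = \<mu>\<^sup>2 * ip0 (lbr x a) (lbr y b)"
    unfolding nab_self ip1_kk_plus_pp[OF zero zero in_pp(2) in_pp(1)]
    by (simp add: ip0.scaleR_left ip0.scaleR_right ip0.zero_left power2_eq_square ip0_commute[of "lbr y b"])
  have in_kk: "s *\<^sub>R (u + r) \<in> kk" for s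
    using k by (intro subspace_scale[OF subspace_kk] subspace_add[OF subspace_kk])
  have in_pp2: "(1/2) *\<^sub>R (q + m1 + m2 + \<mu> *\<^sub>R (m1 - m2)) \<in> pp"
      "(1/2) *\<^sub>R (- (q + m1 + m2) + \<mu> *\<^sub>R (m1 - m2)) \<in> pp" "q + m1 + m2 \<in> pp" "u + r \<in> kk"
    using p k in_kk[of 1]
    by (auto intro!: subspace_scale[OF subspace_pp] subspace_add[OF subspace_pp] subspace_diff[OF subspace_pp]
        subspace_neg[OF subspace_pp])
  note comm = ip0_commute[of m1 q] ip0_commute[of m2 q] ip0_commute[of m2 m1] ip0_commute[of r u]
  note expand = ip0.add_left ip0.add_right ip0.diff_left ip0.diff_right ip0.scaleR_left ip0.scaleR_right
    ip0.minus_left ip0.minus_right comm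
  have T2: "4 * ip1 t (nab t X Y) (nab t Y X) = \<mu>\<^sup>2 * (ip0 m1 m1 - 2 * ip0 m1 m2 + ip0 m2 m2)
      - (1 - \<mu>) * (ip0 u u + 2 * ip0 u r + ip0 r r)
      - (ip0 q q + ip0 m1 m1 + ip0 m2 m2 + 2 * ip0 q m1 + 2 * ip0 q m2 + 2 * ip0 m1 m2)"
    unfolding nab_XY nab_YX ip1_kk_plus_pp[OF in_kk in_kk in_pp2(1,2)] lam
    by (simp add: expand power2_eq_square field_simps)
  have phi: "phi t X = X - \<mu> *\<^sub>R x" "phi t Y = Y - \<mu> *\<^sub>R y"
    unfolding X_def Y_def phi_kk_plus_pp[OF xy(1) ab(1)] phi_kk_plus_pp[OF xy(2) ab(2)] lam
    by (simp_all add: algebra_simps)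
  \<comment> \<open>Koszul's formula followed by invariance expresses this term through
    \<open>B\<close>, \<open>u\<close>, \<open>m1\<close> and \<open>m2\<close>; the closed form of
    \<open>nab\<close> would bring in brackets with the components of
    \<open>lbr X Y\<close>.\<close>
  have "ip1 t (nab t (lbr X Y) Y) X = (1/2) * (ip1 t (lbr (lbr X Y) Y) X - ip1 t (lbr Y X) (lbr X Y)
      + ip1 t (lbr X (lbr X Y)) Y)"
    by (rule koszul[OF t gg_lbr[OF XY] XY(2,1)])
  also have "ip1 t (lbr (lbr X Y) Y) X = ip0 B (lbr Y (phi t X))"
    by (simp add: ip1_def ip0_lbr B)
  also have "ip1 t (lbr X (lbr X Y)) Y = ip0 B (lbr (phi t Y) X)"
    using ip0_lbr[of "phi t Y" X B] by (simp add: ip1_def B ip0_commute[of _ "phi t Y"] ip0_commute[of B])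
  also have "lbr Y (phi t X) = - B + \<mu> *\<^sub>R (u + m1)"
  proof -
    have Yx: "lbr Y x = - (u + m1)"
      unfolding Y_def lbr.add_left lbr_commute[of y x] lbr_commute[of b x] u m1_def by simp
    show ?thesis
      unfolding phi lbr.diff_right lbr.scaleR_right lbr_commute[of Y X] B Yx scaleR_minus_right by simp
  qed
  also have "lbr (phi t Y) X = - B + \<mu> *\<^sub>R (u + m2)"
  proof -
    have yX: "lbr y X = - (u + m2)"
      unfolding X_def lbr.add_right lbr_commute[of y x] lbr_commute[of y a] u m2_def by simp
    show ?thesis
      unfolding phi lbr.diff_left lbr.scaleR_left lbr_commute[of Y X] B yX scaleR_minus_right by simp
  qed
  also have "ip1 t (lbr Y X) (lbr X Y) = - ip1 t B B"
    unfolding lbr_commute[of Y X] B ip1.minus_left ..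
  also have "ip1 t B B = (1 - \<mu>) * (ip0 u u + 2 * ip0 u r + ip0 r r)
      + (ip0 q q + ip0 m1 m1 + ip0 m2 m2 + 2 * ip0 q m1 + 2 * ip0 q m2 + 2 * ip0 m1 m2)"
    unfolding B_def ip1_kk_plus_pp[OF in_pp2(4,4,3,3)] lam
    by (simp add: expand algebra_simps)
  finally have T3: "2 * ip1 t (nab t (lbr X Y) Y) X = ip0 B (- B + \<mu> *\<^sub>R (u + m1)) + ip0 B (- B + \<mu> *\<^sub>R (u + m2))
      + (1 - \<mu>) * (ip0 u u + 2 * ip0 u r + ip0 r r)
      + (ip0 q q + ip0 m1 m1 + ip0 m2 m2 + 2 * ip0 q m1 + 2 * ip0 q m2 + 2 * ip0 m1 m2)"
    by simp
  have cross: "ip0 c z = 0" "ip0 z c = 0" if "c \<in> {u, r}" "z \<in> {q, m1, m2}" for c z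
    using that k p ip0_pp_kk by auto
  have BB: "ip0 B (- B + \<mu> *\<^sub>R (u + m1)) + ip0 B (- B + \<mu> *\<^sub>R (u + m2)) =
      - 2 * (ip0 u u + 2 * ip0 u r + ip0 r r)
      - 2 * (ip0 q q + ip0 m1 m1 + ip0 m2 m2 + 2 * ip0 q m1 + 2 * ip0 q m2 + 2 * ip0 m1 m2)
      + \<mu> * (2 * ip0 u u + 2 * ip0 u r + ip0 q m1 + ip0 q m2 + ip0 m1 m1 + ip0 m2 m2 + 2 * ip0 m1 m2)"
    by (simp add: B_def expand cross algebra_simps)
  \<comment> \<open>The Jacobi identity trades the product in \<open>T1\<close> for quantities that
    occur in the other terms.\<close>
  have "ip0 m1 m2 + ip0 (lbr x a) (lbr y b) = ip0 u (lbr a b)"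
  proof -
    have "lbr b (lbr a y) + lbr a (lbr y b) = lbr y (lbr a b)"
      using lbr_jacobi[of b a y] unfolding lbr_commute[of b a] lbr.minus_right by simp
    then show ?thesis
      by (simp add: m1_def m2_def u ip0_lbr flip: ip0.add_right)
  qed
  also have "lbr a b = r + q" by (simp add: r q kpart_plus_ppart)
  finally have J: "ip0 (lbr x a) (lbr y b) = ip0 u r - ip0 m1 m2"
    using cross by (simp add: ip0.add_right)
  \<comment> \<open>Metric compatibility moves the outer derivative to the other argument, leaving
    products of first covariant derivatives in the first two terms.\<close>
  have "ip1 t (Rm t X Y Y) X = - ip1 t (nab t Y Y) (nab t X X) + ip1 t (nab t X Y) (nab t Y X)
      - ip1 t (nab t (lbr X Y) Y) X"
    unfolding Rm_def ip1.diff_left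
    using ip1_nab_skew[OF t XY(1) nab_in_gg[OF XY(2,2)] XY(1)]
      ip1_nab_skew[OF t XY(2) nab_in_gg[OF XY(1,2)] XY(1)]
      ip1_commute[of t "nab t X X"] ip1_commute[of t "nab t Y X"]
    by simp
  then have "4 * ip1 t (Rm t X Y Y) X = - 4 * (\<mu>\<^sup>2 * (ip0 u r - ip0 m1 m2))
      + (\<mu>\<^sup>2 * (ip0 m1 m1 - 2 * ip0 m1 m2 + ip0 m2 m2)
      - (1 - \<mu>) * (ip0 u u + 2 * ip0 u r + ip0 r r)
      - (ip0 q q + ip0 m1 m1 + ip0 m2 m2 + 2 * ip0 q m1 + 2 * ip0 q m2 + 2 * ip0 m1 m2))
      - 2 * (2 * ip1 t (nab t (lbr X Y) Y) X)"
    using T1 T2 J by simp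
  also have "\<dots> = ip0 ((1 - \<mu>) *\<^sub>R m + q) ((1 - \<mu>) *\<^sub>R m + q)
    + (1 - \<mu>) * ip0 (u + (1 + 2 * \<mu>) *\<^sub>R r) (u + (1 + 2 * \<mu>) *\<^sub>R r) + 4 * \<mu> ^ 3 * ip0 r r"
    unfolding T3 BB mm
    by (simp add: expand power2_eq_square power3_eq_cube) algebra
  finally show ?thesis by (simp add: X_def Y_def)
qed

section \<open>Nonnegativity and vanishing of the curvature\<close>

text \<open>Brackets within \<open>kk\<close> stay in \<open>kk\<close> and mixed brackets lie in
  \<open>pp\<close>. As G2/SU(3) is not a symmetric space, brackets within \<open>pp\<close>
  contribute to both components.\<close>

lemma lbr_components_eq_0:
  assumes x: "x \<in> kk" "y \<in> kk" and a: "a \<in> pp" "b \<in> pp"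
  shows "lbr (x + a) (y + b) = 0 \<longleftrightarrow>
    lbr x y + kpart (lbr a b) = 0 \<and> lbr x b + lbr a y + ppart (lbr a b) = 0"
    (is "?L = 0 \<longleftrightarrow> ?k = 0 \<and> ?p = 0")
proof -
  have "lbr a b \<in> gg" using a pp_subset_gg gg_lbr by blast
  then have mem: "?k \<in> kk" "?p \<in> pp"
    using x a by (auto simp: kk_lbr kpart_in_kk ppart_in_pp lbr_kk_pp lbr_pp_kk
        intro!: subspace_add[OF subspace_kk] subspace_add[OF subspace_pp])
  have L: "?L = ?k + ?p"
    using kpart_plus_ppart[of "lbr a b"] by (simp add: lbr.add_left lbr.add_right algebra_simps)
  show ?thesis
    using kpart_kk_plus_pp[OF mem] linear_0[OF linear_kpart] L kpart_plus_ppart[of ?L] by force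
qed

text \<open>The \<open>kk\<close>-component of \<open>lbr A B = 0\<close> says that the bracket of
  the \<open>kk\<close>-parts is minus the \<open>kk\<close>-component of the bracket of the
  \<open>pp\<close>-parts. If it vanishes, \<open>lbr_pp_eq_0\<close> makes the whole bracket of the
  \<open>pp\<close>-parts vanish.\<close>

lemma commuting_parts_iff:
  assumes A: "A \<in> gg" and B: "B \<in> gg" and comm: "lbr A B = 0"
  shows "lbr (kpart A) (kpart B) = 0 \<longleftrightarrow> lbr (ppart A) (ppart B) = 0"
proof -
  have p: "ppart A \<in> pp" "ppart B \<in> pp" using A B ppart_in_pp by auto
  have "lbr (kpart A + ppart A) (kpart B + ppart B) = 0"
    using comm by (simp add: kpart_plus_ppart)
  then have k: "lbr (kpart A) (kpart B) + kpart (lbr (ppart A) (ppart B)) = 0"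
    using lbr_components_eq_0[OF kpart_in_kk kpart_in_kk p] by blast
  show ?thesis
  proof
    assume "lbr (kpart A) (kpart B) = 0"
    with k have "ip0 (lbr (ppart A) (ppart B)) J = 0" if "J \<in> kk" for J
      using ip0_minus_kpart[OF that, of "lbr (ppart A) (ppart B)"] by simp
    then show "lbr (ppart A) (ppart B) = 0" by (rule lbr_pp_eq_0[OF p])
  next
    assume "lbr (ppart A) (ppart B) = 0"
    with k show "lbr (kpart A) (kpart B) = 0" by (simp add: linear_0[OF linear_kpart])
  qed
qed

text \<open>The coefficients in the sum of squares are positive because \<mu> lies strictly between
  0 and 1, so the curvature vanishes exactly if every square does.\<close>

lemma curvature_nonneg:
  assumes t: "t > 0" and V: "V \<in> gg" and W: "W \<in> gg"
  shows "0 \<le> ip1 t (Rm t V W W) V"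
    and "ip1 t (Rm t V W W) V = 0 \<longleftrightarrow>
      lbr (phi t V) (phi t W) = 0 \<and> lbr (kpart (phi t V)) (kpart (phi t W)) = 0"
proof -
  obtain x a where xa: "x \<in> kk" "a \<in> pp" "V = x + a" using gg_decompose[OF V] .
  obtain y b where yb: "y \<in> kk" "b \<in> pp" "W = y + b" using gg_decompose[OF W] .
  define \<mu> where "\<mu> = 1 / (t + 1)"
  define l where "l = 1 - \<mu>"
  have \<mu>: "\<mu> > 0" and l: "l > 0" and lam: "t / (t + 1) = l" using t by (simp_all add: l_def \<mu>_def field_simps)
  define u r q m where "u = lbr x y" and "r = kpart (lbr a b)" and "q = ppart (lbr a b)"
    and "m = lbr x b + lbr a y"
  have "lbr a b \<in> gg" using xa yb pp_subset_gg gg_lbr by blast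
  then have "q \<in> pp" "m \<in> pp"
    using subspace_add[OF subspace_pp lbr_kk_pp[OF xa(1) yb(2)] lbr_pp_kk[OF xa(2) yb(1)]]
    by (simp_all add: q_def m_def ppart_in_pp)
  then have "q \<in> gg" "m \<in> gg" using pp_subset_gg by auto
  moreover have ur: "u \<in> gg" "r \<in> gg"
    using xa yb kk_subset_gg kk_lbr by (auto simp: u_def r_def kpart_in_gg)
  ultimately have mem: "l *\<^sub>R m + q \<in> gg" "u + (1 + 2 * \<mu>) *\<^sub>R r \<in> gg"
    by (auto intro!: subspace_add[OF subspace_gg] subspace_scale[OF subspace_gg])
  have sos: "4 * ip1 t (Rm t V W W) V = ip0 (l *\<^sub>R m + q) (l *\<^sub>R m + q)
    + l * ip0 (u + (1 + 2 * \<mu>) *\<^sub>R r) (u + (1 + 2 * \<mu>) *\<^sub>R r) + 4 * \<mu> ^ 3 * ip0 r r"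
    unfolding xa(3) yb(3) l_def
    by (rule curvature_sum_of_squares[OF t xa(1) yb(1) xa(2) yb(2) \<mu>_def r_def q_def u_def m_def])
  have nn: "0 \<le> ip0 (l *\<^sub>R m + q) (l *\<^sub>R m + q)"
    "0 \<le> l * ip0 (u + (1 + 2 * \<mu>) *\<^sub>R r) (u + (1 + 2 * \<mu>) *\<^sub>R r)" "0 \<le> 4 * \<mu> ^ 3 * ip0 r r"
    using \<mu> l mem ur by (auto intro!: mult_nonneg_nonneg ip0_self_nonneg)
  show "0 \<le> ip1 t (Rm t V W W) V" using sos nn by linarith
  have "ip1 t (Rm t V W W) V = 0 \<longleftrightarrow> ip0 (l *\<^sub>R m + q) (l *\<^sub>R m + q) = 0 \<and>
      l * ip0 (u + (1 + 2 * \<mu>) *\<^sub>R r) (u + (1 + 2 * \<mu>) *\<^sub>R r) = 0 \<and> 4 * \<mu> ^ 3 * ip0 r r = 0"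
    using sos nn by linarith
  \<comment> \<open>The last square forces \<open>r = 0\<close>, after which the middle one forces
    \<open>u = 0\<close>.\<close>
  also have "\<dots> \<longleftrightarrow> l *\<^sub>R m + q = 0 \<and> u = 0 \<and> r = 0"
    using \<mu> l ip0_self_eq_0[OF mem(1)] ip0_self_eq_0[OF mem(2)] ip0_self_eq_0[OF ur(2)] by auto
  \<comment> \<open>The bracket on the right has \<open>kk\<close>-component
    \<open>l^2 u + r\<close> and \<open>pp\<close>-component \<open>l m + q\<close>; its two
    arguments are \<open>phi t V\<close> and \<open>phi t W\<close>.\<close>
  also have "\<dots> \<longleftrightarrow> lbr (l *\<^sub>R x + a) (l *\<^sub>R y + b) = 0 \<and> lbr (l *\<^sub>R x) (l *\<^sub>R y) = 0"
    using l xa yb subspace_scale[OF subspace_kk]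
    by (auto simp: lbr_components_eq_0 lbr.scaleR_left lbr.scaleR_right u_def r_def q_def m_def
        scaleR_add_right)
  also have "\<dots> \<longleftrightarrow> lbr (phi t V) (phi t W) = 0 \<and> lbr (kpart (phi t V)) (kpart (phi t W)) = 0"
    using xa yb by (simp add: phi_kk_plus_pp lam kpart_kk_plus_pp subspace_scale[OF subspace_kk])
  finally show "ip1 t (Rm t V W W) V = 0 \<longleftrightarrow>
      lbr (phi t V) (phi t W) = 0 \<and> lbr (kpart (phi t V)) (kpart (phi t W)) = 0" .
qed

section \<open>The product metric and its sectional curvature\<close>

lemma bounded_bilinear_ip2: "bounded_bilinear (ip2 t)"
proof -
  have "bilinear (ip2 t)"
    unfolding bilinear_def ip2_def
    by (intro conjI allI linearI)
      (simp_all add: bounded_bilinear.add_left[OF bounded_bilinear_ip1]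
        bounded_bilinear.add_right[OF bounded_bilinear_ip1] bounded_bilinear.scaleR_left[OF bounded_bilinear_ip1]
        bounded_bilinear.scaleR_right[OF bounded_bilinear_ip1] algebra_simps)
  then show ?thesis by (simp add: bilinear_conv_bounded_bilinear)
qed

lemma ip2_pos:
  assumes "t > 0" "V \<in> gg \<times> gg" "V \<noteq> 0" shows "ip2 t V V > 0"
proof -
  have "ip1 t U U \<ge> 0" if "U \<in> gg" for U
    using ip1_pos[OF that _ assms(1), THEN less_imp_le]
    by (cases "U = 0") (simp_all add: bounded_bilinear.zero_left[OF bounded_bilinear_ip1])
  moreover have "fst V \<in> gg" "snd V \<in> gg" "fst V \<noteq> 0 \<or> snd V \<noteq> 0"
    using assms by (auto simp: zero_prod_def)
  ultimately show ?thesis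
    unfolding ip2_def using ip1_pos[OF _ _ assms(1)]
    by (metis add_nonneg_pos add_pos_nonneg)
qed

lemma subspace_gg2: "subspace (gg \<times> gg)"
  by (rule subspace_Times[OF subspace_gg subspace_gg])

text \<open>The pair of connections satisfies the Koszul formula componentwise, and positive
  definiteness of \<open>ip2 t\<close> makes the solution unique, which resolves the definite
  description in \<open>lc\<close>.\<close>

lemma lc_gg2:
  assumes t: "t > 0" and V: "V \<in> gg \<times> gg" and W: "W \<in> gg \<times> gg"
  shows "lc (gg \<times> gg) br2 (ip2 t) V W = (nab t (fst V) (fst W), nab t (snd V) (snd W))" (is "_ = ?N")
  unfolding lc_def
proof (rule the_equality)
  have g: "fst V \<in> gg" "snd V \<in> gg" "fst W \<in> gg" "snd W \<in> gg" using V W by auto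
  have N: "?N \<in> gg \<times> gg \<and> (\<forall>Z\<in>gg \<times> gg.
      ip2 t ?N Z = (1/2) * (ip2 t (br2 V W) Z - ip2 t (br2 W Z) V + ip2 t (br2 Z V) W))"
    using g by (auto simp: nab_in_gg ip2_def br2_def koszul[OF t] algebra_simps add_divide_distrib diff_divide_distrib)
  then show "?N \<in> gg \<times> gg \<and> (\<forall>Z\<in>gg \<times> gg.
      ip2 t ?N Z = (1/2) * (ip2 t (br2 V W) Z - ip2 t (br2 W Z) V + ip2 t (br2 Z V) W))" .
  fix U assume U: "U \<in> gg \<times> gg \<and> (\<forall>Z\<in>gg \<times> gg.
      ip2 t U Z = (1/2) * (ip2 t (br2 V W) Z - ip2 t (br2 W Z) V + ip2 t (br2 Z V) W))"
  have mem: "U - ?N \<in> gg \<times> gg" using U N subspace_diff[OF subspace_gg2] by blast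
  have "ip2 t (U - ?N) (U - ?N) = ip2 t U (U - ?N) - ip2 t ?N (U - ?N)"
    by (rule bounded_bilinear.diff_left[OF bounded_bilinear_ip2])
  also have "\<dots> = 0" using U N mem by (metis (no_types, lifting) diff_self)
  finally have "U - ?N = 0" using ip2_pos[OF t mem] by (metis less_irrefl)
  then show "U = ?N" by simp
qed

lemma curv_gg2:
  assumes t: "t > 0" and V: "V \<in> gg \<times> gg" and W: "W \<in> gg \<times> gg"
  shows "curv (gg \<times> gg) br2 (ip2 t) V W W
    = (Rm t (fst V) (fst W) (fst W), Rm t (snd V) (snd W) (snd W))"
proof -
  have g: "fst V \<in> gg" "snd V \<in> gg" "fst W \<in> gg" "snd W \<in> gg" using V W by auto
  then show ?thesis
    using V W by (simp add: curv_def lc_gg2[OF t] nab_in_gg br2_def gg_lbr mem_Times_iff Rm_def)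
qed

text \<open>Strict Cauchy-Schwarz. Since division by zero yields 0 in HOL, \<open>sec_curv\<close>
  being 0 means a vanishing numerator only once this denominator is known to be nonzero.\<close>

lemma lin_indep2_imp_gram_pos:
  assumes t: "t > 0" and V: "V \<in> gg \<times> gg" and W: "W \<in> gg \<times> gg" and ind: "lin_indep2 V W"
  shows "ip2 t V V * ip2 t W W - (ip2 t V W)\<^sup>2 > 0"
proof -
  interpret ip2: bounded_bilinear "ip2 t" by (rule bounded_bilinear_ip2)
  have sym: "ip2 t W V = ip2 t V W" by (simp add: ip2_def ip1_commute)
  have "W \<noteq> 0" using ind by (metis lin_indep2_def scaleR_zero_left scaleR_zero_right add_0 zero_neq_one)
  then have W0: "ip2 t W W > 0" by (rule ip2_pos[OF t W])
  \<comment> \<open>The component of \<open>V\<close> orthogonal to \<open>W\<close>, scaled to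
    avoid a division.\<close>
  define Z where "Z = ip2 t W W *\<^sub>R V + (- ip2 t V W) *\<^sub>R W"
  have "Z \<noteq> 0" using ind W0 unfolding lin_indep2_def Z_def by (metis less_irrefl)
  moreover have "Z \<in> gg \<times> gg"
    unfolding Z_def using V W by (intro subspace_add[OF subspace_gg2] subspace_scale[OF subspace_gg2])
  ultimately have "ip2 t Z Z > 0" by (intro ip2_pos[OF t])
  also have "ip2 t Z Z = ip2 t W W * (ip2 t V V * ip2 t W W - (ip2 t V W)\<^sup>2)"
    unfolding Z_def ip2.add_left ip2.add_right ip2.scaleR_left ip2.scaleR_right sym
    by (simp add: power2_eq_square algebra_simps)
  finally show ?thesis using W0 by (simp add: zero_less_mult_iff)
qed

lemma sec_curv_eq_0_iff:
  assumes t: "t > 0" and V: "V \<in> gg \<times> gg" and W: "W \<in> gg \<times> gg" and ind: "lin_indep2 V W"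
  shows "sec_curv (gg \<times> gg) br2 (ip2 t) V W = 0 \<longleftrightarrow>
    lbr (phi t (fst V)) (phi t (fst W)) = 0 \<and> lbr (kpart (phi t (fst V))) (kpart (phi t (fst W))) = 0 \<and>
    lbr (phi t (snd V)) (phi t (snd W)) = 0 \<and> lbr (kpart (phi t (snd V))) (kpart (phi t (snd W))) = 0"
proof -
  have g: "fst V \<in> gg" "snd V \<in> gg" "fst W \<in> gg" "snd W \<in> gg" using V W by auto
  have "sec_curv (gg \<times> gg) br2 (ip2 t) V W = 0 \<longleftrightarrow>
      ip1 t (Rm t (fst V) (fst W) (fst W)) (fst V) + ip1 t (Rm t (snd V) (snd W) (snd W)) (snd V) = 0"
    using lin_indep2_imp_gram_pos[OF assms] by (simp add: sec_curv_def curv_gg2[OF t V W] ip2_def[of t "(_, _)"])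
  also have "\<dots> \<longleftrightarrow> ip1 t (Rm t (fst V) (fst W) (fst W)) (fst V) = 0 \<and>
      ip1 t (Rm t (snd V) (snd W) (snd W)) (snd V) = 0"
    by (intro add_nonneg_eq_0_iff curvature_nonneg(1)[OF t] g)
  finally show ?thesis
    by (simp add: curvature_nonneg(2)[OF t] g)
qed

subsection \<open>Horizontal vectors\<close>

definition phi_inv :: "real \<Rightarrow> real^7^7 \<Rightarrow> real^7^7" where
  "phi_inv t Y = ((t + 1) / t) *\<^sub>R kpart Y + ppart Y"

lemma phi_inv_kk_plus_pp: "x \<in> kk \<Longrightarrow> a \<in> pp \<Longrightarrow> phi_inv t (x + a) = ((t + 1) / t) *\<^sub>R x + a"
  by (simp add: phi_inv_def kpart_kk_plus_pp)

lemma phi_phi_inv: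
  assumes "t > 0" "X \<in> gg"
  shows "phi t (phi_inv t X) = X" "phi_inv t (phi t X) = X" "phi_inv t X \<in> gg"
proof -
  obtain x a where xa: "x \<in> kk" "a \<in> pp" "X = x + a" using gg_decompose[OF assms(2)] .
  have k: "s *\<^sub>R x \<in> kk" for s using xa subspace_scale[OF subspace_kk] by blast
  show "phi t (phi_inv t X) = X" "phi_inv t (phi t X) = X"
    using assms(1) unfolding xa(3) phi_inv_kk_plus_pp[OF xa(1,2)] phi_kk_plus_pp[OF xa(1,2)]
      phi_inv_kk_plus_pp[OF k xa(2)] phi_kk_plus_pp[OF k xa(2)] by simp_all
  show "phi_inv t X \<in> gg"
    unfolding xa(3) phi_inv_kk_plus_pp[OF xa(1,2)]
    using k xa kk_subset_gg pp_subset_gg by (intro subspace_add[OF subspace_gg]) auto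
qed

section \<open>The adjoint action and the horizontal space\<close>

lemma Ad_inv_G2: assumes "g \<in> G2" shows "Ad_inv g X = transpose g ** X ** g"
proof -
  have o: "g ** transpose g = mat 1" "transpose g ** g = mat 1"
    using assms by (auto simp: G2_iff orthogonal_matrix_def)
  \<comment> \<open>\<open>matrix_inv\<close> is defined by choice; the transpose witnesses that an
    inverse exists.\<close>
  then have "matrix_inv g ** g = mat 1"
    unfolding matrix_inv_def by (rule_tac someI2[of _ "transpose g"]) auto
  then have "matrix_inv g = transpose g"
    using o by (metis matrix_mul_assoc matrix_mul_lid matrix_mul_rid)
  then show ?thesis by (simp add: Ad_inv_def)
qed

lemma Ad_inv_in_gg: assumes "g \<in> G2" "X \<in> gg" shows "Ad_inv g X \<in> gg"
  using G2.lie_alg_conj[OF transpose_in_G2[OF assms(1)], of X] assms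
  by (simp add: Ad_inv_G2 gg_def)

lemma linear_Ad_inv: "linear (Ad_inv g)"
  by (rule linearI) (simp_all add: Ad_inv_def mm.add_left mm.add_right mm.scaleR_left mm.scaleR_right)

lemma G2_cancel:
  assumes "g \<in> G2"
  shows "g ** (transpose g ** X) = X" "transpose g ** (g ** X) = X"
  using assms by (simp_all add: matrix_mul_assoc G2_iff orthogonal_matrix_def)

lemma ip0_Ad_inv: assumes "g \<in> G2" shows "ip0 (Ad_inv g X) (Ad_inv g Y) = ip0 X Y"
proof -
  have "trace (transpose g ** (X ** (Y ** g))) = trace (X ** (Y ** g) ** transpose g)"
    by (rule trace_mul_sym)
  then show ?thesis
    using assms by (simp add: ip0_def Ad_inv_G2[OF assms] G2_cancel[OF assms] G2_iff orthogonal_matrix_def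
      flip: matrix_mul_assoc)
qed

lemma Ad_inv_transpose: assumes "g \<in> G2" shows "Ad_inv g (Ad_inv (transpose g) X) = X"
  using assms transpose_in_G2[OF assms]
  by (simp add: Ad_inv_G2 G2_cancel G2_iff orthogonal_matrix_def flip: matrix_mul_assoc)

definition hat :: "real \<Rightarrow> real^7^7 \<Rightarrow> real^7^7 \<Rightarrow> gg2" where
  "hat t g X = (phi_inv t (- Ad_inv g X), phi_inv t X)"

lemma ip1_eq_ip0_phi: "ip1 t X Y = ip0 (phi t X) Y"
  using ip1_commute[of t X Y] by (simp add: ip1_def ip0_commute)

text \<open>Vertical vectors with \<open>Z = 0\<close> force \<open>phi t (snd V)\<close> to be
  orthogonal to \<open>hh\<close>; those with \<open>W = 0\<close> determine
  \<open>phi t (fst V)\<close>, because \<open>Ad_inv g\<close> is an isometry of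
  \<open>ip0\<close>.\<close>

lemma horiz_eq_image_hat:
  assumes g: "g \<in> G2" and t: "t > 0"
  shows "horiz t g = hat t g ` {X \<in> gg. \<forall>Z\<in>hh. ip0 X Z = 0}"
proof (intro equalityI subsetI)
  fix V assume V: "V \<in> horiz t g"
  then have gV: "fst V \<in> gg" "snd V \<in> gg" by (auto simp: horiz_def)
  have orth: "ip0 (phi t (fst V)) (Ad_inv g Z) + ip0 (phi t (snd V)) (Z - W) = 0"
    if "Z \<in> gg" "W \<in> hh" for Z W
  proof -
    have "(Ad_inv g Z, Z - W) \<in> vert g" using that by (auto simp: vert_def)
    then have "ip2 t V (Ad_inv g Z, Z - W) = 0" using V by (auto simp: horiz_def)
    then show ?thesis by (simp add: ip2_def ip1_eq_ip0_phi)
  qed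
  define X where "X = phi t (snd V)"
  define D where "D = phi t (fst V) + Ad_inv g X"
  have X: "X \<in> gg" unfolding X_def by (rule phi_in_gg[OF gV(2)])
  have "ip0 X Z = 0" if "Z \<in> hh" for Z
    using orth[OF subspace_0[OF subspace_gg] that] linear_0[OF linear_Ad_inv]
    by (simp add: X_def ip0.zero_right ip0.minus_right)
  moreover have "D = 0"
  proof -
    have D: "D \<in> gg"
      unfolding D_def using gV X g by (intro subspace_add[OF subspace_gg] phi_in_gg Ad_inv_in_gg)
    \<comment> \<open>Chosen so that \<open>Ad_inv g Z = D\<close>; orthogonality of
      \<open>V\<close> to \<open>(Ad_inv g Z, Z)\<close> then reads
      \<open>ip0 D D = 0\<close>.\<close>
    define Z where "Z = Ad_inv (transpose g) D"
    have Z: "Z \<in> gg" "Ad_inv g Z = D"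
      using D g by (simp_all add: Z_def Ad_inv_in_gg transpose_in_G2 Ad_inv_transpose)
    have "ip0 D D = ip0 (phi t (fst V)) (Ad_inv g Z) + ip0 X Z"
      using ip0_Ad_inv[OF g, of X Z] by (simp add: Z(2)) (simp add: D_def ip0.add_left)
    also have "\<dots> = 0" using orth[OF Z(1) zero_in_hh] by (simp add: X_def)
    finally show ?thesis using ip0_self_eq_0[OF D] by blast
  qed
  then have "fst V = phi_inv t (- Ad_inv g X)"
    using phi_phi_inv(2)[OF t gV(1)] by (simp add: D_def add_eq_0_iff2)
  then have "V = hat t g X"
    using phi_phi_inv(2)[OF t gV(2)] by (simp add: hat_def X_def prod_eq_iff)
  ultimately show "V \<in> hat t g ` {X \<in> gg. \<forall>Z\<in>hh. ip0 X Z = 0}" using X by blast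
next
  fix V assume "V \<in> hat t g ` {X \<in> gg. \<forall>Z\<in>hh. ip0 X Z = 0}"
  then obtain X where X: "X \<in> gg" "\<And>Z. Z \<in> hh \<Longrightarrow> ip0 X Z = 0" and V: "V = hat t g X" by blast
  have A: "- Ad_inv g X \<in> gg" using Ad_inv_in_gg[OF g X(1)] subspace_neg[OF subspace_gg] by blast
  have "ip2 t V (Ad_inv g Z, Z - W) = 0" if "Z \<in> gg" "W \<in> hh" for Z W
    using X(2)[OF that(2)] ip0_Ad_inv[OF g, of X Z]
    by (simp add: V hat_def ip2_def ip1_eq_ip0_phi phi_phi_inv[OF t] A X(1) ip0.minus_left ip0.diff_right)
  then show "V \<in> horiz t g"
    using phi_phi_inv(3)[OF t A] phi_phi_inv(3)[OF t X(1)]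
    by (auto simp: horiz_def vert_def V hat_def)
qed

lemma linear_hat: "linear (hat t g)"
proof -
  have "linear (phi_inv t)"
    by (rule linearI) (simp_all add: phi_inv_def ppart_def linear_add[OF linear_kpart]
      linear_scale[OF linear_kpart] algebra_simps)
  then show ?thesis
    by (intro linearI)
      (simp_all add: hat_def linear_add[OF linear_Ad_inv] linear_scale[OF linear_Ad_inv] linear_add linear_scale
        linear_neg linear_diff)
qed

text \<open>The second component of \<open>hat t g\<close> is \<open>phi_inv t\<close>, which is
  invertible on \<open>gg\<close>, so the linear map \<open>hat t g\<close> is injective there and
  planes correspond to planes.\<close>

lemma lin_indep2_hat_iff:
  assumes t: "t > 0" and X: "X \<in> gg" and Y: "Y \<in> gg"
  shows "lin_indep2 (hat t g X) (hat t g Y) \<longleftrightarrow> lin_indep2 X Y"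
proof -
  have "a *\<^sub>R hat t g X + b *\<^sub>R hat t g Y = 0 \<longleftrightarrow> a *\<^sub>R X + b *\<^sub>R Y = 0" for a b
  proof -
    have mem: "a *\<^sub>R X + b *\<^sub>R Y \<in> gg"
      using X Y by (intro subspace_add[OF subspace_gg] subspace_scale[OF subspace_gg])
    have "a *\<^sub>R hat t g X + b *\<^sub>R hat t g Y = hat t g (a *\<^sub>R X + b *\<^sub>R Y)"
      by (simp add: linear_add[OF linear_hat] linear_scale[OF linear_hat])
    moreover have "hat t g Z = 0 \<longleftrightarrow> Z = 0" if "Z \<in> gg" for Z
      using phi_phi_inv(1)[OF t that] linear_0[OF linear_hat] linear_0[OF linear_phi]
      by (metis hat_def snd_conv snd_zero)
    ultimately show ?thesis using mem by simp
  qed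
  then show ?thesis by (simp add: lin_indep2_def)
qed

text \<open>\<open>phi t\<close> undoes \<open>phi_inv t\<close> in both components, and the sign in
  \<open>hat\<close> drops out of the brackets. The curvature criterion concerns
  \<open>kk\<close>-parts; \<open>commuting_parts_iff\<close> exchanges them for
  \<open>pp\<close>-parts on the \<open>Ad_inv\<close> side and adds the \<open>pp\<close>-condition
  for \<open>X\<close> and \<open>Y\<close>.\<close>

lemma sec_curv_hat_eq_0_iff:
  assumes g: "g \<in> G2" and t: "t > 0" and X: "X \<in> gg" and Y: "Y \<in> gg" and ind: "lin_indep2 X Y"
  shows "sec_curv (gg \<times> gg) br2 (ip2 t) (hat t g X) (hat t g Y) = 0 \<longleftrightarrow>
    lbr X Y = 0 \<and> lbr (kpart X) (kpart Y) = 0 \<and> lbr (ppart X) (ppart Y) = 0 \<and>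
    lbr (Ad_inv g X) (Ad_inv g Y) = 0 \<and> lbr (ppart (Ad_inv g X)) (ppart (Ad_inv g Y)) = 0"
proof -
  have A: "Ad_inv g X \<in> gg" "Ad_inv g Y \<in> gg" using g X Y by (auto intro: Ad_inv_in_gg)
  then have A': "- Ad_inv g X \<in> gg" "- Ad_inv g Y \<in> gg" using subspace_neg[OF subspace_gg] by auto
  have "hat t g X \<in> gg \<times> gg" "hat t g Y \<in> gg \<times> gg"
    using A' X Y t by (auto simp: hat_def phi_phi_inv)
  moreover have "lin_indep2 (hat t g X) (hat t g Y)" using ind lin_indep2_hat_iff[OF t X Y] by blast
  ultimately have "sec_curv (gg \<times> gg) br2 (ip2 t) (hat t g X) (hat t g Y) = 0 \<longleftrightarrow>
      lbr (Ad_inv g X) (Ad_inv g Y) = 0 \<and> lbr (kpart (Ad_inv g X)) (kpart (Ad_inv g Y)) = 0 \<and>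
      lbr X Y = 0 \<and> lbr (kpart X) (kpart Y) = 0"
    by (simp add: sec_curv_eq_0_iff[OF t] hat_def phi_phi_inv[OF t] A' X Y lbr.minus_left lbr.minus_right
        linear_neg[OF linear_kpart])
  then show ?thesis
    using commuting_parts_iff[OF A] commuting_parts_iff[OF X Y] by blast
qed

theorem mainTheorem9:
  fixes g :: "real^7^7" and t :: real
  assumes "g \<in> G2" and "t > 0"
  shows "(\<exists>V W. V \<in> horiz t g \<and> W \<in> horiz t g \<and> lin_indep2 V W \<and>
              sec_curv (gg \<times> gg) br2 (ip2 t) V W = 0)
     \<longleftrightarrow>
         (\<exists>X Y. X \<in> gg \<and> Y \<in> gg \<and> lin_indep2 X Y \<and>
              (\<forall>Z\<in>hh. ip0 X Z = 0 \<and> ip0 Y Z = 0) \<and>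
              lbr X Y = 0 \<and> lbr (kpart X) (kpart Y) = 0 \<and> lbr (ppart X) (ppart Y) = 0 \<and>
              lbr (Ad_inv g X) (Ad_inv g Y) = 0 \<and>
              lbr (ppart (Ad_inv g X)) (ppart (Ad_inv g Y)) = 0)"
proof -
  let ?S = "{X \<in> gg. \<forall>Z\<in>hh. ip0 X Z = 0}"
  have "(\<exists>V W. V \<in> horiz t g \<and> W \<in> horiz t g \<and> lin_indep2 V W \<and>
        sec_curv (gg \<times> gg) br2 (ip2 t) V W = 0) \<longleftrightarrow>
     (\<exists>X\<in>?S. \<exists>Y\<in>?S. lin_indep2 (hat t g X) (hat t g Y) \<and>
        sec_curv (gg \<times> gg) br2 (ip2 t) (hat t g X) (hat t g Y) = 0)"
    unfolding horiz_eq_image_hat[OF assms] by blast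
  also have "\<dots> \<longleftrightarrow> (\<exists>X\<in>?S. \<exists>Y\<in>?S. lin_indep2 X Y \<and>
      lbr X Y = 0 \<and> lbr (kpart X) (kpart Y) = 0 \<and> lbr (ppart X) (ppart Y) = 0 \<and>
      lbr (Ad_inv g X) (Ad_inv g Y) = 0 \<and> lbr (ppart (Ad_inv g X)) (ppart (Ad_inv g Y)) = 0)"
    using lin_indep2_hat_iff[OF assms(2)] sec_curv_hat_eq_0_iff[OF assms]
    by (intro bex_cong refl) blast
  finally show ?thesis by blast
qed

end
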